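(* For every $\epsilon>0$ there exist a sufficiently small $p_0>0$ and a sufficiently large $A$ such that for all $0<p\le p_0$ and all positive integers $n\ge A/\sqrt{p}$: (i) $(1-\epsilon)2n\sqrt{p}\le\mathbb{E}[L(\mathcal{S}(K_{n,n},p))]\le(1+\epsilon)2n\sqrt{p}$; (ii) every median of $L(\mathcal{S}(K_{n,n},p))$ lies in $[(1-\epsilon)2n\sqrt{p},(1+\epsilon)2n\sqrt{p}]$; (iii) there is an absolute constant $C>0$ such that $\Pr[L(\mathcal{S}(K_{n,n},p))\le(1-\epsilon)2n\sqrt{p}]\le\exp(-C\epsilon^2n\sqrt{p})$ and $\Pr[L(\mathcal{S}(K_{n,n},p))\ge(1+\epsilon)2n\sqrt{p}]\le\exp(-C\frac{\epsilon^2}{1+\epsilon}n\sqrt{p})$.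
   Context: $K_{n,n}$ is the complete bipartite graph with color classes two disjoint copies of $[n]$ (natural order), edges $(i,j)\in[n]\times[n]$. $\mathcal{S}(K_{n,n},p)$ is the distribution of the random subgraph in which, for each pair $1\le i<j\le n$ independently, with probability $p$ both edges $(i,j)$ and $(j,i)$ are present and otherwise neither; edges $(i,i)$ are never present. A non-crossing matching is a set of pairwise vertex-disjoint edges pairwise comparable in the componentwise order; $L(G)$ is the maximum size of a non-crossing matching of $G$ and $L(\mathcal{F})$ is $L(G)$ for $G\sim\mathcal{F}$. *)

theory Defs
  imports "HOL-Probability.Probability" "HOL-Probability.Product_PMF"
begin

text \<open>
  A bipartite graph on two disjoint copies of \<open>{1..n}\<close> is represented by its set of edges
  \<open>(i, j)\<close>, where \<open>i\<close> is a vertex of the first and \<open>j\<close> a vertex of the second color class.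
\<close>

type_synonym bigraph = "(nat \<times> nat) set"

definition complete_bigraph :: "nat \<Rightarrow> bigraph" where
  "complete_bigraph n = {1..n} \<times> {1..n}"

text \<open>
  Since the color classes are disjoint copies, the edges \<open>(i, j)\<close> and \<open>(j, k)\<close> do not share the
  vertex \<open>j\<close>: vertices are only compared within the same color class.
\<close>

definition vertex_disjoint :: "nat \<times> nat \<Rightarrow> nat \<times> nat \<Rightarrow> bool" where
  "vertex_disjoint e f \<longleftrightarrow> fst e \<noteq> fst f \<and> snd e \<noteq> snd f"

definition comp_le :: "nat \<times> nat \<Rightarrow> nat \<times> nat \<Rightarrow> bool" where
  "comp_le e f \<longleftrightarrow> fst e \<le> fst f \<and> snd e \<le> snd f"

definition noncrossing_matching :: "bigraph \<Rightarrow> bool" where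
  "noncrossing_matching M \<longleftrightarrow>
     pairwise vertex_disjoint M \<and> pairwise (\<lambda>e f. comp_le e f \<or> comp_le f e) M"

text \<open>Only meaningful for finite \<open>G\<close>.\<close>

definition L :: "bigraph \<Rightarrow> nat" where
  "L G = Max {card M | M. M \<subseteq> G \<and> noncrossing_matching M}"

text \<open>
  One independent coin \<open>c (i, j)\<close> of bias \<open>p\<close> for each pair \<open>i < j\<close> decides about both edges
  \<open>(i, j)\<close> and \<open>(j, i)\<close>. For \<open>p\<close> outside of \<open>[0, 1]\<close>, \<open>bernoulli_pmf\<close> truncates \<open>p\<close> to that interval.
\<close>

definition sym_bigraph_pmf :: "nat \<Rightarrow> real \<Rightarrow> bigraph pmf" where
  "sym_bigraph_pmf n p =
     map_pmf (\<lambda>c. {(i, j) \<in> complete_bigraph n. (i < j \<and> c (i, j)) \<or> (j < i \<and> c (j, i))})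
       (Pi_pmf {(i, j) \<in> {1..n} \<times> {1..n}. i < j} False (\<lambda>_. bernoulli_pmf p))"

definition is_median :: "'a pmf \<Rightarrow> ('a \<Rightarrow> real) \<Rightarrow> real \<Rightarrow> bool" where
  "is_median D X m \<longleftrightarrow>
     measure_pmf.prob D {x. X x \<le> m} \<ge> 1 / 2 \<and> measure_pmf.prob D {x. X x \<ge> m} \<ge> 1 / 2"

end

theory Submission
  imports Defs
begin

text \<open>
  Reflecting edges across the diagonal turns the symmetric model into last passage percolation with
  independent cells strictly above the diagonal. That is dominated by percolation on the full square,
  so upper bounds may be proved there. Adding Bernoulli sources (density \<open>a\<close>) on the bottom and sinks
  (density \<open>b\<close>) on the left with \<open>a b = p (1 - a) (1 - b)\<close> makes the increments stationary (Burke's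
  property), so the last passage time with boundary is a sum of two binomial variables. This gives all
  upper bounds; on squares it also gives the lower bound \<open>2 n sqrt p\<close>, because a path that leaves the
  boundary far from the corner loses a quadratic amount.

  For the lower tail, place disjoint squares \<open>I\<^sub>k \<times> I\<^sub>k\<^sub>+\<^sub>j\<close> of side \<open>K / sqrt p\<close>
  above the diagonal. For each of the \<open>J\<close> offsets \<open>j\<close> the squares concatenate to a long chain, so a
  small passage time forces a positive fraction of bad squares for all \<open>J\<close> offsets simultaneously. Since
  \<open>J\<close> may be any constant, the tail decays faster than any prescribed exponential rate.
\<close>

section \<open>Non-crossing matchings and last passage times\<close>

text \<open>The obstacle is that C may not depend on \<epsilon>. With N = n sqrt p, a single row of
  m blocks of side K / sqrt p yields about exp(-m), where m is of order N / K, and K grows faster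
  than 1 / \<epsilon>^2 as \<epsilon> shrinks. Using J offsets multiplies the number of independent
  blocks by J but shortens each row by only J blocks, a bounded loss that A absorbs, since A may
  depend on \<epsilon>. Hence squares need only a law of large numbers with some fixed small failure
  probability, and no concentration inequality for L itself enters. The blocks stay off the
  diagonal, so their cells carry independent coins although the graph is symmetric. In the upper
  bounds nothing depends on block sizes: the moment generating function of L at y \<ge> 0 is at most
  exp(N (exp(2 y) - 1)) for every n, which is that of twice a Poisson variable of mean N and
  explains the value 2 N.\<close>

definition strictly_below :: "nat \<times> nat \<Rightarrow> nat \<times> nat \<Rightarrow> bool" where
  "strictly_below e f \<longleftrightarrow> fst e < fst f \<and> snd e < snd f"

text \<open>Distinct endpoints in both color classes make a componentwise comparison strict in each
  coordinate. From here on, non-crossing matchings are treated as strict chains of cells.\<close>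

lemma noncrossing_matching_iff:
  "noncrossing_matching M \<longleftrightarrow>
     (\<forall>e\<in>M. \<forall>f\<in>M. e \<noteq> f \<longrightarrow> strictly_below e f \<or> strictly_below f e)"
proof -
  have "vertex_disjoint e f \<and> (comp_le e f \<or> comp_le f e) \<longleftrightarrow>
      strictly_below e f \<or> strictly_below f e" for e f
    unfolding vertex_disjoint_def comp_le_def strictly_below_def by linarith
  thus ?thesis unfolding noncrossing_matching_def pairwise_def by blast
qed

lemma finite_matching_sizes:
  assumes "finite G"
  shows "finite {card M | M. M \<subseteq> G \<and> noncrossing_matching M}"
proof -
  have "{card M | M. M \<subseteq> G \<and> noncrossing_matching M} \<subseteq> card ` Pow G" by auto
  thus ?thesis using assms by (meson finite_Pow_iff finite_imageI finite_subset)
qed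

lemma card_le_L:
  assumes "finite G" "M \<subseteq> G" "noncrossing_matching M"
  shows "card M \<le> L G"
  unfolding L_def using assms by (intro Max_ge finite_matching_sizes) auto

lemma L_attained:
  assumes "finite G"
  obtains M where "M \<subseteq> G" "noncrossing_matching M" "card M = L G" "finite M"
proof -
  have "noncrossing_matching {}" by (simp add: noncrossing_matching_iff)
  hence "{card M | M. M \<subseteq> G \<and> noncrossing_matching M} \<noteq> {}" by blast
  hence "L G \<in> {card M | M. M \<subseteq> G \<and> noncrossing_matching M}"
    unfolding L_def using finite_matching_sizes[OF assms] by (intro Max_in) auto
  then obtain M where "M \<subseteq> G" "noncrossing_matching M" "card M = L G" by auto
  with finite_subset[OF this(1) assms] that show thesis by blast
qed

lemma L_mono:
  assumes "finite G'" "G \<subseteq> G'"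
  shows "L G \<le> L G'"
proof -
  have "finite G" using assms finite_subset by blast
  then obtain M where "M \<subseteq> G" "noncrossing_matching M" "card M = L G"
    by (rule L_attained)
  with card_le_L[of G' M] assms show ?thesis by auto
qed

lemma L_empty [simp]: "L {} = 0"
  by (rule L_attained[of "{}"]) auto

text \<open>The map \<open>h\<close> may identify elements of \<open>G\<close>: on a chain,
  preserving the strict order already forces injectivity. Reflection across the diagonal, which is
  two-to-one, relies on this.\<close>

lemma L_le_L_image:
  assumes "finite G"
    and "\<And>e f. \<lbrakk>e \<in> G; f \<in> G; strictly_below e f\<rbrakk> \<Longrightarrow> strictly_below (h e) (h f)"
  shows "L G \<le> L (h ` G)"
proof -
  obtain M where M: "M \<subseteq> G" "noncrossing_matching M" "card M = L G" "finite M"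
    using L_attained[OF assms(1)] by blast
  have neq: "h e \<noteq> h f" if "e \<in> M" "f \<in> M" "e \<noteq> f" for e f
    using that M(1,2) assms(2) unfolding noncrossing_matching_iff
    by (metis nat_less_le strictly_below_def subsetD)
  hence "inj_on h M" by (auto simp: inj_on_def)
  hence "card (h ` M) = L G" using M(3) by (simp add: card_image)
  moreover have "noncrossing_matching (h ` M)"
    using M(1,2) assms(2) unfolding noncrossing_matching_iff by (smt (verit) image_iff subsetD)
  moreover have "h ` M \<subseteq> h ` G" using M(1) by blast
  ultimately show ?thesis using card_le_L[of "h ` G" "h ` M"] assms(1) by auto
qed

lemma L_Un_ge:
  assumes "finite G" "finite H"
    and "\<And>e f. \<lbrakk>e \<in> G; f \<in> H\<rbrakk> \<Longrightarrow> strictly_below e f"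
  shows "L G + L H \<le> L (G \<union> H)"
proof -
  obtain M where M: "M \<subseteq> G" "noncrossing_matching M" "card M = L G" "finite M"
    using L_attained[OF assms(1)] by blast
  obtain N where N: "N \<subseteq> H" "noncrossing_matching N" "card N = L H" "finite N"
    using L_attained[OF assms(2)] by blast
  have "M \<inter> N = {}" using M(1) N(1) assms(3) by (force simp: strictly_below_def)
  hence "card (M \<union> N) = L G + L H" using M N by (simp add: card_Un_disjoint)
  moreover have "noncrossing_matching (M \<union> N)"
    using M(1,2) N(1,2) assms(3) unfolding noncrossing_matching_iff by blast
  ultimately show ?thesis using card_le_L[of "G \<union> H" "M \<union> N"] M(1) N(1) assms(1,2) by auto
qed

lemma sum_L_le_L_UN:
  fixes G :: "nat \<Rightarrow> bigraph"
  assumes "\<And>k. k < m \<Longrightarrow> finite (G k)"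
    and "\<And>k l e f. \<lbrakk>k < l; l < m; e \<in> G k; f \<in> G l\<rbrakk> \<Longrightarrow> strictly_below e f"
  shows "(\<Sum>k<m. L (G k)) \<le> L (\<Union>k<m. G k)"
  using assms
proof (induction m)
  case (Suc m)
  have "(\<Sum>k<m. L (G k)) \<le> L (\<Union>k<m. G k)"
    using Suc.prems by (intro Suc.IH) (auto intro: less_SucI)
  moreover have "L (\<Union>k<m. G k) + L (G m) \<le> L ((\<Union>k<m. G k) \<union> G m)"
    using Suc.prems by (intro L_Un_ge) auto
  moreover have "(\<Union>k<m. G k) \<union> G m = (\<Union>k<Suc m. G k)" by (auto simp: lessThan_Suc)
  ultimately show ?case by simp
qed simp

text \<open>This is Bernoulli last passage percolation in the strict-strict version, a discrete
  relative of Hammersley's process.\<close>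

definition lpp :: "(nat \<times> nat \<Rightarrow> bool) \<Rightarrow> (nat \<times> nat) set \<Rightarrow> nat" where
  "lpp c R = L {e \<in> R. c e}"

lemma lpp_cong: "(\<And>e. e \<in> R \<Longrightarrow> c e = c' e) \<Longrightarrow> lpp c R = lpp c' R"
  unfolding lpp_def by (metis (mono_tags, lifting) Collect_cong)

lemma lpp_mono: "finite R' \<Longrightarrow> R \<subseteq> R' \<Longrightarrow> lpp c R \<le> lpp c R'"
  unfolding lpp_def by (intro L_mono) auto

lemma lpp_translate:
  assumes "finite R"
  shows "lpp c ((\<lambda>(i, j). (i + s, j + t)) ` R) = lpp (c \<circ> (\<lambda>(i, j). (i + s, j + t))) R"
    (is "lpp c (?h ` R) = _")
proof -
  let ?G = "{e \<in> R. (c \<circ> ?h) e}"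
  have im: "{e \<in> ?h ` R. c e} = ?h ` ?G" by auto
  have "L ?G \<le> L (?h ` ?G)"
    using assms by (intro L_le_L_image) (auto simp: strictly_below_def)
  moreover have "L (?h ` ?G) \<le> L ((\<lambda>(i, j). (i - s, j - t)) ` ?h ` ?G)"
    using assms by (intro L_le_L_image) (auto simp: strictly_below_def)
  moreover have "(\<lambda>(i, j). (i - s, j - t)) ` ?h ` ?G = ?G"
    by (simp add: image_image case_prod_unfold)
  ultimately show ?thesis unfolding lpp_def im by simp
qed

definition upper_triangle :: "nat \<Rightarrow> (nat \<times> nat) set" where
  "upper_triangle n = {(i, j) \<in> {1..n} \<times> {1..n}. i < j}"

lemma finite_triangle [simp]: "finite (upper_triangle n)"
  unfolding upper_triangle_def by (rule finite_subset[of _ "{1..n} \<times> {1..n}"]) auto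

text \<open>Reflecting each edge into the triangle maps strict chains to strict chains.\<close>

lemma L_symmetric_eq_lpp_triangle:
  "L {(i, j) \<in> complete_bigraph n. (i < j \<and> c (i, j)) \<or> (j < i \<and> c (j, i))} = lpp c (upper_triangle n)"
  (is "L ?G = _")
proof (rule antisym)
  have fin: "finite ?G"
    by (rule finite_subset[of _ "{1..n} \<times> {1..n}"]) (auto simp: complete_bigraph_def)
  let ?h = "\<lambda>(i::nat, j::nat). (min i j, max i j)"
  have "L ?G \<le> L (?h ` ?G)"
    using fin by (intro L_le_L_image) (auto simp: strictly_below_def min_def max_def)
  also have "\<dots> \<le> lpp c (upper_triangle n)"
    unfolding lpp_def
    by (intro L_mono finite_subset[OF Collect_restrict finite_triangle])
      (auto simp: upper_triangle_def complete_bigraph_def min_def max_def)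
  finally show "L ?G \<le> lpp c (upper_triangle n)" .
  show "lpp c (upper_triangle n) \<le> L ?G"
    unfolding lpp_def using fin by (intro L_mono) (auto simp: upper_triangle_def complete_bigraph_def)
qed

section \<open>Last passage times with boundary and their exit points\<close>

text \<open>Besides the interior cells, the path may collect coins \<open>(k, 0)\<close> or \<open>(0, l)\<close> along one of the
  axes before it enters the interior.\<close>

fun lpp_bd :: "(nat \<times> nat \<Rightarrow> bool) \<Rightarrow> nat \<Rightarrow> nat \<Rightarrow> nat" where
  "lpp_bd c 0 0 = 0"
| "lpp_bd c (Suc i) 0 = lpp_bd c i 0 + of_bool (c (Suc i, 0))"
| "lpp_bd c 0 (Suc j) = lpp_bd c 0 j + of_bool (c (0, Suc j))"
| "lpp_bd c (Suc i) (Suc j) =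
     max (max (lpp_bd c i (Suc j)) (lpp_bd c (Suc i) j)) (lpp_bd c i j + of_bool (c (Suc i, Suc j)))"

text \<open>A chain in the rectangle contains the corner cell, avoids the last column or avoids the
  last row: a cell in the last column and a different one in the last row would have to be strictly
  comparable, and then one of them would leave the rectangle. These are the three branches of the
  recursion; the boundary coins can only help.\<close>

lemma lpp_le_lpp_bd: "lpp c ({1..i} \<times> {1..j}) \<le> lpp_bd c i j"
proof (induction c i j rule: lpp_bd.induct)
  case (4 c i j)
  let ?R = "\<lambda>i j. {1..i} \<times> {1..j}"
  obtain M where M: "M \<subseteq> {e \<in> ?R (Suc i) (Suc j). c e}" "noncrossing_matching M"
    "card M = lpp c (?R (Suc i) (Suc j))" "finite M"
    unfolding lpp_def by (rule L_attained[of "{e \<in> ?R (Suc i) (Suc j). c e}"]) auto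
  have sub: "card N \<le> lpp c (?R i' j')" if "N \<subseteq> M" "N \<subseteq> ?R i' j'" for N i' j'
  proof -
    have "noncrossing_matching N"
      using that(1) M(2) unfolding noncrossing_matching_iff by blast
    moreover have "N \<subseteq> {e \<in> ?R i' j'. c e}" using that M(1) by auto
    ultimately show ?thesis unfolding lpp_def by (intro card_le_L) auto
  qed
  consider "(Suc i, Suc j) \<in> M" | "\<forall>e\<in>M. fst e \<noteq> Suc i" | "\<forall>e\<in>M. snd e \<noteq> Suc j"
  proof -
    have "(Suc i, Suc j) \<in> M" if "e \<in> M" "fst e = Suc i" "f \<in> M" "snd f = Suc j" for e f
    proof (cases "e = f")
      case True with that show ?thesis by (metis prod.collapse)
    next
      case False
      hence "strictly_below e f \<or> strictly_below f e"
        using M(2) that by (auto simp: noncrossing_matching_iff)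
      moreover have "fst f \<le> Suc i" "snd e \<le> Suc j" using M(1) that by auto
      ultimately show ?thesis using that by (auto simp: strictly_below_def)
    qed
    thus ?thesis using that by blast
  qed
  thus ?case
  proof cases
    case 1
    have "M - {(Suc i, Suc j)} \<subseteq> ?R i j"
    proof
      fix e assume e: "e \<in> M - {(Suc i, Suc j)}"
      hence "strictly_below e (Suc i, Suc j) \<or> strictly_below (Suc i, Suc j) e"
        using M(2) 1 by (auto simp: noncrossing_matching_iff)
      moreover have "e \<in> ?R (Suc i) (Suc j)" using e M(1) by auto
      ultimately show "e \<in> ?R i j" by (auto simp: strictly_below_def)
    qed
    hence "card (M - {(Suc i, Suc j)}) \<le> lpp c (?R i j)" by (intro sub) auto
    moreover have "card M = Suc (card (M - {(Suc i, Suc j)}))"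
      using 1 M(4) by (metis card.remove)
    moreover have "c (Suc i, Suc j)" using 1 M(1) by auto
    ultimately show ?thesis using 4 M(3) by simp
  next
    case 2
    hence "M \<subseteq> ?R i (Suc j)" using M(1) by (fastforce simp: le_Suc_eq)
    hence "card M \<le> lpp c (?R i (Suc j))" by (intro sub) auto
    thus ?thesis using 4 M(3) by simp
  next
    case 3
    hence "M \<subseteq> ?R (Suc i) j" using M(1) by (fastforce simp: le_Suc_eq)
    hence "card M \<le> lpp c (?R (Suc i) j)" by (intro sub) auto
    thus ?thesis using 4 M(3) by simp
  qed
qed (auto simp: lpp_def)

lemma lpp_bd_bottom: "lpp_bd c i 0 = (\<Sum>k=1..i. of_bool (c (k, 0)))"
  by (induction i) auto

lemma lpp_bd_left: "lpp_bd c 0 j = (\<Sum>k=1..j. of_bool (c (0, k)))"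
  by (induction j) auto

lemma lpp_add_corner:
  assumes "z \<le> i" "z' \<le> j"
  shows "lpp c ({z<..i} \<times> {z'<..j}) + of_bool (c (Suc i, Suc j))
           \<le> lpp c ({z<..Suc i} \<times> {z'<..Suc j})"
proof -
  have "lpp c ({z<..i} \<times> {z'<..j}) + L (if c (Suc i, Suc j) then {(Suc i, Suc j)} else {})
      \<le> L ({e \<in> {z<..i} \<times> {z'<..j}. c e} \<union> (if c (Suc i, Suc j) then {(Suc i, Suc j)} else {}))"
    unfolding lpp_def by (intro L_Un_ge) (auto simp: strictly_below_def split: if_splits)
  also have "\<dots> \<le> lpp c ({z<..Suc i} \<times> {z'<..Suc j})"
    unfolding lpp_def using assms by (intro L_mono) (auto split: if_splits)
  finally have 1: "lpp c ({z<..i} \<times> {z'<..j}) + L (if c (Suc i, Suc j) then {(Suc i, Suc j)} else {})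
      \<le> lpp c ({z<..Suc i} \<times> {z'<..Suc j})" .
  have "card {(Suc i, Suc j)} \<le> L {(Suc i, Suc j)}"
    by (rule card_le_L) (auto simp: noncrossing_matching_iff)
  with 1 show ?thesis by (auto split: if_splits)
qed

text \<open>Following the recursion backwards, an optimal path runs along one axis up to an exit
  point \<open>z\<close>, and what it collects afterwards is a strict chain in the interior beyond
  \<open>z\<close>.\<close>

lemma lpp_bd_exit:
  "(\<exists>z\<le>i. lpp_bd c i j \<le> lpp_bd c z 0 + lpp c ({z<..i} \<times> {0<..j})) \<or>
   (\<exists>z\<le>j. lpp_bd c i j \<le> lpp_bd c 0 z + lpp c ({0<..i} \<times> {z<..j}))"
proof (induction c i j rule: lpp_bd.induct)
  case (2 c i) show ?case by (intro disjI1 exI[of _ "Suc i"]) auto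
next
  case (3 c j) show ?case by (intro disjI2 exI[of _ "Suc j"]) auto
next
  case (4 c i j)
  let ?E = "\<lambda>g i j. (\<exists>z\<le>i. g \<le> lpp_bd c z 0 + lpp c ({z<..i} \<times> {0<..j})) \<or>
   (\<exists>z\<le>j. g \<le> lpp_bd c 0 z + lpp c ({0<..i} \<times> {z<..j}))"
  have mono: "?E g (Suc i) (Suc j)" if "?E g i' j'" "i' \<le> Suc i" "j' \<le> Suc j" for g i' j'
    using that(1)
  proof (elim disjE exE conjE)
    fix z assume z: "z \<le> i'" "g \<le> lpp_bd c z 0 + lpp c ({z<..i'} \<times> {0<..j'})"
    have "lpp c ({z<..i'} \<times> {0<..j'}) \<le> lpp c ({z<..Suc i} \<times> {0<..Suc j})"
      using that by (intro lpp_mono) auto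
    with z that show ?thesis by (intro disjI1 exI[of _ z]) auto
  next
    fix z assume z: "z \<le> j'" "g \<le> lpp_bd c 0 z + lpp c ({0<..i'} \<times> {z<..j'})"
    have "lpp c ({0<..i'} \<times> {z<..j'}) \<le> lpp c ({0<..Suc i} \<times> {z<..Suc j})"
      using that by (intro lpp_mono) auto
    with z that show ?thesis by (intro disjI2 exI[of _ z]) auto
  qed
  have corner: "?E (lpp_bd c i j + of_bool (c (Suc i, Suc j))) (Suc i) (Suc j)"
    using 4(3)
  proof (elim disjE exE conjE)
    fix z assume z: "z \<le> i" "lpp_bd c i j \<le> lpp_bd c z 0 + lpp c ({z<..i} \<times> {0<..j})"
    with lpp_add_corner[of z i 0 j c] show ?thesis by (intro disjI1 exI[of _ z]) auto
  next
    fix z assume z: "z \<le> j" "lpp_bd c i j \<le> lpp_bd c 0 z + lpp c ({0<..i} \<times> {z<..j})"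
    with lpp_add_corner[of 0 i z j c] show ?thesis by (intro disjI2 exI[of _ z]) auto
  qed
  have "?E (lpp_bd c i (Suc j)) (Suc i) (Suc j)" by (rule mono[OF 4(1)]) auto
  moreover have "?E (lpp_bd c (Suc i) j) (Suc i) (Suc j)" by (rule mono[OF 4(2)]) auto
  moreover have "lpp_bd c (Suc i) (Suc j) = lpp_bd c i (Suc j) \<or>
      lpp_bd c (Suc i) (Suc j) = lpp_bd c (Suc i) j \<or>
      lpp_bd c (Suc i) (Suc j) = lpp_bd c i j + of_bool (c (Suc i, Suc j))"
    unfolding lpp_bd.simps by linarith
  ultimately show ?case using corner by presburger
qed auto

section \<open>Burke's property\<close>

text \<open>Boolean because all increments turn out to be 0 or 1. At index 0 the truncated
  subtraction makes the value \<open>False\<close>.\<close>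

definition hinc :: "(nat \<times> nat \<Rightarrow> bool) \<Rightarrow> nat \<Rightarrow> nat \<Rightarrow> bool" where
  "hinc c i j \<longleftrightarrow> lpp_bd c i j \<noteq> lpp_bd c (i - 1) j"

definition vinc :: "(nat \<times> nat \<Rightarrow> bool) \<Rightarrow> nat \<Rightarrow> nat \<Rightarrow> bool" where
  "vinc c i j \<longleftrightarrow> lpp_bd c i j \<noteq> lpp_bd c i (j - 1)"

text \<open>Both directions share one induction: the horizontal increment above a cell is controlled
  by the two increments entering that cell from below and from the left, and likewise for the
  vertical one.\<close>

lemma lpp_bd_increments:
  "lpp_bd c (Suc i) j \<in> {lpp_bd c i j, Suc (lpp_bd c i j)} \<and>
   lpp_bd c i (Suc j) \<in> {lpp_bd c i j, Suc (lpp_bd c i j)}"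
proof (induction c i j rule: lpp_bd.induct)
  case (1 c) show ?case by auto
next
  case (2 c i) thus ?case by (auto simp: max_def)
next
  case (3 c j) thus ?case by (auto simp: max_def)
next
  case (4 c i j)
  have "lpp_bd c (Suc (Suc i)) (Suc j) \<in> {lpp_bd c (Suc i) (Suc j), Suc (lpp_bd c (Suc i) (Suc j))}"
    unfolding lpp_bd.simps(4)[of c "Suc i" j] using 4(2)
    by (cases "c (Suc (Suc i), Suc j)") (auto simp del: lpp_bd.simps)
  moreover have "lpp_bd c (Suc i) (Suc (Suc j)) \<in> {lpp_bd c (Suc i) (Suc j), Suc (lpp_bd c (Suc i) (Suc j))}"
    unfolding lpp_bd.simps(4)[of c i "Suc j"] using 4(1)
    by (cases "c (Suc i, Suc (Suc j))") (auto simp del: lpp_bd.simps)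
  ultimately show ?case by blast
qed

lemma lpp_bd_Suc_left: "lpp_bd c (Suc i) j = lpp_bd c i j + of_bool (hinc c (Suc i) j)"
  using lpp_bd_increments[of c i j] by (auto simp: hinc_def)

lemma lpp_bd_Suc_right: "lpp_bd c i (Suc j) = lpp_bd c i j + of_bool (vinc c i (Suc j))"
  using lpp_bd_increments[of c i j] by (auto simp: vinc_def)

lemma lpp_bd_top: "lpp_bd c n j = lpp_bd c 0 j + (\<Sum>i=1..n. of_bool (hinc c i j))"
  by (induction n) (auto simp: lpp_bd_Suc_left)

lemma hinc_bottom: "hinc c (Suc i) 0 = c (Suc i, 0)"
  by (auto simp: hinc_def)

lemma vinc_left: "vinc c 0 (Suc j) = c (0, Suc j)"
  by (auto simp: vinc_def)

text \<open>If \<open>x\<close> and \<open>y\<close> are the increments along the bottom and left side of a cell (or vice versa) with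
  coin \<open>w\<close>, this is the increment along the side opposite to that of \<open>x\<close>.\<close>

definition flip_inc :: "bool \<Rightarrow> bool \<Rightarrow> bool \<Rightarrow> bool" where
  "flip_inc x y w = (if x = y then \<not> x \<and> w else x)"

lemma hinc_Suc_Suc:
  "hinc c (Suc i) (Suc j) = flip_inc (hinc c (Suc i) j) (vinc c i (Suc j)) (c (Suc i, Suc j))"
  using lpp_bd_Suc_left[of c i j] lpp_bd_Suc_right[of c i j]
  by (auto simp: hinc_def[of _ _ "Suc j"] flip_inc_def max_def)

lemma vinc_Suc_Suc:
  "vinc c (Suc i) (Suc j) = flip_inc (vinc c i (Suc j)) (hinc c (Suc i) j) (c (Suc i, Suc j))"
  using lpp_bd_Suc_left[of c i j] lpp_bd_Suc_right[of c i j]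
  by (auto simp: vinc_def[of _ "Suc i"] flip_inc_def max_def)

abbreviation coins :: "(nat \<times> nat) set \<Rightarrow> (nat \<times> nat \<Rightarrow> real) \<Rightarrow> (nat \<times> nat \<Rightarrow> bool) pmf" where
  "coins S q \<equiv> Pi_pmf S False (\<lambda>e. bernoulli_pmf (q e))"

text \<open>Mixed pairs are unchanged by \<open>flip_inc\<close>, two \<open>True\<close> always
  become two \<open>False\<close>, and two \<open>False\<close> become two \<open>True\<close> when
  the coin is \<open>True\<close>. The assumption on \<open>a * b\<close> says that the masses moved
  in these two directions agree.\<close>

lemma burke_bernoulli:
  assumes "0 \<le> a" "a \<le> 1" "0 \<le> b" "b \<le> 1" "0 \<le> p" "p \<le> 1" "a * b = p * (1 - a) * (1 - b)"
  shows "do {x \<leftarrow> bernoulli_pmf a; y \<leftarrow> bernoulli_pmf b; w \<leftarrow> bernoulli_pmf p;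
             return_pmf (flip_inc x y w, flip_inc y x w)} =
         pair_pmf (bernoulli_pmf a) (bernoulli_pmf b)" (is "?l = ?r")
proof (rule pmf_eqI)
  fix z :: "bool \<times> bool"
  obtain u v where z: "z = (u, v)" by fastforce
  show "pmf ?l z = pmf ?r z"
    using assms unfolding z pmf_pair
    by (cases u; cases v) (simp_all add: pmf_bind flip_inc_def, (simp add: algebra_simps)+)
qed

text \<open>The increments leaving the cell \<open>e\<close> overwrite those entering it, and the
  spent coin is set to the default \<open>False\<close>, so that the result can again be distributed
  as a family of \<open>coins\<close>, on one cell fewer.\<close>

definition burke_step :: "nat \<times> nat \<Rightarrow> (nat \<times> nat \<Rightarrow> bool) \<Rightarrow> nat \<times> nat \<Rightarrow> bool" where
  "burke_step e c = c(e := False, (fst e, 0) := flip_inc (c (fst e, 0)) (c (0, snd e)) (c e),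
     (0, snd e) := flip_inc (c (0, snd e)) (c (fst e, 0)) (c e))"

locale burke =
  fixes a b p :: real and q :: "nat \<times> nat \<Rightarrow> real"
  assumes ab: "0 \<le> a" "a \<le> 1" "0 \<le> b" "b \<le> 1" "0 \<le> p" "p \<le> 1"
    and stationary: "a * b = p * (1 - a) * (1 - b)"
  defines "q \<equiv> \<lambda>e. if snd e = 0 then a else if fst e = 0 then b else p"
begin

lemma map_burke_step:
  assumes "finite S" "(i, 0) \<in> S" "(0, j) \<in> S" "(i, j) \<in> S" "i > 0" "j > 0"
  shows "map_pmf (burke_step (i, j)) (coins S q) = coins (S - {(i, j)}) q"
proof -
  define R where "R = S - {(i, j), (i, 0), (0, j)}"
  have R: "finite R" "(i, j) \<notin> R" "(i, 0) \<notin> R" "(0, j) \<notin> R" using assms by (auto simp: R_def)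
  have S1: "S - {(i, j)} = insert (i, 0) (insert (0, j) R)"
    and S2: "S = insert (i, 0) (insert (0, j) (insert (i, j) R))"
    using assms by (auto simp: R_def)
  have q: "q (i, 0) = a" "q (0, j) = b" "q (i, j) = p" using assms by (auto simp: q_def)
  \<comment> \<open>The default value matters here: sampled coins are \<open>False\<close> off
    \<open>R\<close>, so clearing the cell \<open>(i, j)\<close> gives exactly what sampling without
    that cell gives.\<close>
  have out: "f (i, j) = False" if "f \<in> set_pmf (coins R q)" for f
    using that set_Pi_pmf_subset[OF R(1)] R(2) by fastforce
  have "map_pmf (burke_step (i, j)) (coins S q) =
     do {x \<leftarrow> bernoulli_pmf a; y \<leftarrow> bernoulli_pmf b; w \<leftarrow> bernoulli_pmf p; f \<leftarrow> coins R q;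
         return_pmf (burke_step (i, j) (f((i, j) := w, (0, j) := y, (i, 0) := x)))}"
    unfolding S2 using R assms
    by (simp add: Pi_pmf_insert' q map_pmf_def bind_assoc_pmf bind_return_pmf)
  also have "\<dots> = do {x \<leftarrow> bernoulli_pmf a; y \<leftarrow> bernoulli_pmf b; w \<leftarrow> bernoulli_pmf p; f \<leftarrow> coins R q;
         return_pmf (f((0, j) := flip_inc y x w, (i, 0) := flip_inc x y w))}"
    using assms(5,6) by (intro bind_pmf_cong refl arg_cong[of _ _ return_pmf])
      (auto simp: burke_step_def fun_eq_iff out)
  also have "\<dots> = bind_pmf (do {x \<leftarrow> bernoulli_pmf a; y \<leftarrow> bernoulli_pmf b; w \<leftarrow> bernoulli_pmf p;
             return_pmf (flip_inc x y w, flip_inc y x w)})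
           (\<lambda>(x, y). do {f \<leftarrow> coins R q; return_pmf (f((0, j) := y, (i, 0) := x))})"
    by (simp add: bind_assoc_pmf bind_return_pmf)
  also have "\<dots> = do {x \<leftarrow> bernoulli_pmf a; y \<leftarrow> bernoulli_pmf b; f \<leftarrow> coins R q;
         return_pmf (f((0, j) := y, (i, 0) := x))}"
    unfolding burke_bernoulli[OF ab stationary]
    by (simp add: pair_pmf_def bind_assoc_pmf bind_return_pmf)
  also have "\<dots> = coins (S - {(i, j)}) q"
    unfolding S1 using R assms
    by (simp add: Pi_pmf_insert' q bind_assoc_pmf bind_return_pmf)
  finally show ?thesis .
qed

definition bcells :: "nat \<Rightarrow> nat \<Rightarrow> (nat \<times> nat) set" where
  "bcells n m = {0..n} \<times> {0..m} - {(0, 0)}"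

text \<open>The boundary positions \<open>(k, 0)\<close> and \<open>(0, l)\<close> hold the increments along the current down-right
  path: the first \<open>j\<close> rows and the first \<open>i\<close> cells of row \<open>j + 1\<close> lie below it.\<close>

definition path_state :: "nat \<Rightarrow> nat \<Rightarrow> nat \<Rightarrow> (nat \<times> nat \<Rightarrow> bool) \<Rightarrow> nat \<times> nat \<Rightarrow> bool" where
  "path_state n j i c = (\<lambda>(k, l).
     if l = 0 \<and> 0 < k \<and> k \<le> n then hinc c k (if k \<le> i then Suc j else j)
     else if k = 0 \<and> 0 < l then
       (if l \<le> j then vinc c n l else if l = Suc j then vinc c i l else c (0, l))
     else if 0 < k \<and> 0 < l \<and> (k \<le> n \<and> l \<le> j \<or> k \<le> i \<and> l = Suc j) then False
     else c (k, l))"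

lemma path_state_step:
  assumes "i < n"
  shows "path_state n j (Suc i) c = burke_step (Suc i, Suc j) (path_state n j i c)"
proof (rule ext)
  fix e :: "nat \<times> nat"
  obtain k l where e: "e = (k, l)" by fastforce
  show "path_state n j (Suc i) c e = burke_step (Suc i, Suc j) (path_state n j i c) e"
    unfolding e using assms
    by (auto simp: path_state_def burke_step_def hinc_Suc_Suc vinc_Suc_Suc le_Suc_eq)
qed

lemma path_state_next_row: "path_state n (Suc j) 0 c = path_state n j n c"
  by (auto simp: path_state_def fun_eq_iff le_Suc_eq vinc_left)

lemma path_state_0: "path_state n 0 0 c = c"
proof (rule ext)
  fix e :: "nat \<times> nat"
  obtain k l where e: "e = (k, l)" by fastforce
  show "path_state n 0 0 c e = c e"
    unfolding e by (cases k; cases l) (auto simp: path_state_def hinc_bottom vinc_left)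
qed

text \<open>Each cell of a row is one Burke step, which deletes a coin and keeps the remaining ones
  independent with unchanged biases. So the increments along the top of the rectangle are again
  independent with density \<open>a\<close>.\<close>

lemma map_path_state:
  assumes "j \<le> m"
  shows "map_pmf (path_state n j 0) (coins (bcells n m) q) =
           coins (bcells n m - {1..n} \<times> {1..j}) q"
  using assms
proof (induction j)
  case 0 show ?case by (simp add: path_state_0 map_pmf_ident[unfolded id_def])
next
  case (Suc j)
  have "i \<le> n \<Longrightarrow> map_pmf (path_state n j i) (coins (bcells n m) q) =
           coins (bcells n m - {1..n} \<times> {1..j} - {1..i} \<times> {Suc j}) q" for i
  proof (induction i)
    case 0 show ?case using Suc by simp
  next
    case (Suc i)
    let ?S = "bcells n m - {1..n} \<times> {1..j} - {1..i} \<times> {Suc j}"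
    have eq: "path_state n j (Suc i) = burke_step (Suc i, Suc j) \<circ> path_state n j i"
      using Suc.prems by (auto simp: fun_eq_iff path_state_step)
    have "map_pmf (path_state n j (Suc i)) (coins (bcells n m) q) =
        map_pmf (burke_step (Suc i, Suc j)) (coins ?S q)"
      using Suc unfolding eq pmf.map_comp[symmetric] by simp
    also have "\<dots> = coins (?S - {(Suc i, Suc j)}) q"
      using Suc.prems \<open>Suc j \<le> m\<close> by (intro map_burke_step) (auto simp: bcells_def)
    also have "?S - {(Suc i, Suc j)} = bcells n m - {1..n} \<times> {1..j} - {1..Suc i} \<times> {Suc j}"
      by (auto simp: le_Suc_eq)
    finally show ?case .
  qed
  from this[of n] have "map_pmf (path_state n j n) (coins (bcells n m) q) =
           coins (bcells n m - {1..n} \<times> {1..j} - {1..n} \<times> {Suc j}) q" by simp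
  also have "bcells n m - {1..n} \<times> {1..j} - {1..n} \<times> {Suc j} = bcells n m - {1..n} \<times> {1..Suc j}"
    by (auto simp: le_Suc_eq)
  finally show ?case by (simp add: path_state_next_row)
qed

end

section \<open>Exponential moments\<close>

lemma finite_set_coins: "finite S \<Longrightarrow> finite (set_pmf (coins S q))"
  by (rule finite_subset[OF set_Pi_pmf_subset']) (auto intro!: finite_PiE_dflt)

lemma integrable_coins [simp]:
  fixes f :: "_ \<Rightarrow> real"
  shows "finite S \<Longrightarrow> integrable (measure_pmf (coins S q)) f"
  by (intro integrable_measure_pmf_finite finite_set_coins)

lemma map_coins_subset:
  assumes "finite S" "T \<subseteq> S" "\<And>e. e \<in> T \<Longrightarrow> q' e = q e"
    and "\<And>c c'. (\<And>e. e \<in> T \<Longrightarrow> c e = c' e) \<Longrightarrow> f c = f c'"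
  shows "map_pmf f (coins S q) = map_pmf f (coins T q')"
proof -
  have "coins T q' = coins T q"
    using assms(3) by (intro Pi_pmf_cong) auto
  also have "map_pmf f \<dots> = map_pmf (\<lambda>c. f (\<lambda>e. if e \<in> T then c e else False)) (coins S q)"
    by (subst Pi_pmf_subset[OF assms(1,2)]) (simp add: pmf.map_comp o_def)
  also have "\<dots> = map_pmf f (coins S q)"
    by (intro map_pmf_cong refl assms(4)) auto
  finally show ?thesis ..
qed

lemma prob_le_expectation_pmf:
  fixes g :: "'a \<Rightarrow> real"
  assumes "finite (set_pmf M)" "\<And>x. g x \<ge> 0" "\<And>x. x \<in> A \<Longrightarrow> g x \<ge> 1"
  shows "measure_pmf.prob M A \<le> measure_pmf.expectation M g"
proof -
  have "measure_pmf.expectation M (indicator A :: 'a \<Rightarrow> real) \<le> measure_pmf.expectation M g"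
    by (intro integral_mono integrable_measure_pmf_finite assms(1))
      (use assms in \<open>auto simp: indicator_def\<close>)
  thus ?thesis by simp
qed

text \<open>A binomial moment generating function is at most that of the Poisson law with the same
  mean. The sign of \<open>y\<close> is free, as both upper and lower deviations of the boundary
  sums are used.\<close>

lemma mgf_coins_le:
  fixes y :: real
  assumes "finite S" "E \<subseteq> S" "0 \<le> r" "r \<le> 1" "\<And>e. e \<in> E \<Longrightarrow> q e = r"
  shows "measure_pmf.expectation (coins S q) (\<lambda>c. exp (y * (\<Sum>e\<in>E. of_bool (c e))))
           \<le> exp (real (card E) * r * (exp y - 1))"
proof -
  have fE: "finite E" using assms finite_subset by blast
  have "measure_pmf.expectation (coins S q) (\<lambda>c. exp (y * (\<Sum>e\<in>E. of_bool (c e)))) =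
      measure_pmf.expectation (coins E (\<lambda>_. r)) (\<lambda>c. exp (y * (\<Sum>e\<in>E. of_bool (c e))))"
    (is "measure_pmf.expectation _ ?f = _")
  proof -
    have "map_pmf ?f (coins S q) = map_pmf ?f (coins E (\<lambda>_. r))"
      using assms by (intro map_coins_subset arg_cong[where f = "\<lambda>v. exp (y * v)"] sum.cong refl) auto
    hence "measure_pmf.expectation (map_pmf ?f (coins S q)) (\<lambda>x. x) =
      measure_pmf.expectation (map_pmf ?f (coins E (\<lambda>_. r))) (\<lambda>x. x)" by (rule arg_cong)
    thus ?thesis by simp
  qed
  also have "\<dots> = measure_pmf.expectation (coins E (\<lambda>_. r)) (\<lambda>c. \<Prod>e\<in>E. exp (y * of_bool (c e)))"
    unfolding sum_distrib_left exp_sum[OF fE] ..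
  also have "\<dots> = (\<Prod>e\<in>E. measure_pmf.expectation (bernoulli_pmf r) (\<lambda>v. exp (y * of_bool v)))"
    using fE by (intro expectation_prod_Pi_pmf integrable_measure_pmf_finite) auto
  also have "\<dots> = (1 + r * (exp y - 1)) ^ card E"
    using assms by (simp add: algebra_simps)
  also have "\<dots> \<le> exp (r * (exp y - 1)) ^ card E"
  proof (rule power_mono)
    have "0 \<le> (1 - r) + r * exp y" using assms by (intro add_nonneg_nonneg) auto
    thus "0 \<le> 1 + r * (exp y - 1)" by (simp add: algebra_simps)
  qed (rule exp_ge_add_one_self)
  also have "\<dots> = exp (real (card E) * r * (exp y - 1))"
    by (simp add: exp_of_nat_mult[symmetric] algebra_simps)
  finally show ?thesis .
qed

context burke
begin

lemma finite_bcells [simp]: "finite (bcells n m)"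
  by (simp add: bcells_def)

lemma mgf_bottom:
  fixes y :: real
  assumes "z \<le> n"
  shows "measure_pmf.expectation (coins (bcells n m) q) (\<lambda>c. exp (y * lpp_bd c z 0))
    \<le> exp (real z * a * (exp y - 1))"
proof -
  have eq: "real (lpp_bd c z 0) = (\<Sum>e\<in>(\<lambda>k. (k, 0)) ` {1..z}. of_bool (c e))" for c
    by (subst sum.reindex) (auto simp: inj_on_def lpp_bd_bottom)
  have "measure_pmf.expectation (coins (bcells n m) q) (\<lambda>c. exp (y * lpp_bd c z 0))
      \<le> exp (real (card ((\<lambda>k. (k, 0::nat)) ` {1..z})) * a * (exp y - 1))"
    unfolding eq using ab assms by (intro mgf_coins_le) (auto simp: bcells_def q_def)
  also have "card ((\<lambda>k. (k, 0::nat)) ` {1..z}) = z" by (subst card_image) (auto simp: inj_on_def)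
  finally show ?thesis .
qed

lemma mgf_left:
  fixes y :: real
  assumes "z \<le> m"
  shows "measure_pmf.expectation (coins (bcells n m) q) (\<lambda>c. exp (y * lpp_bd c 0 z))
    \<le> exp (real z * b * (exp y - 1))"
proof -
  have eq: "real (lpp_bd c 0 z) = (\<Sum>e\<in>(\<lambda>k. (0, k)) ` {1..z}. of_bool (c e))" for c
    by (subst sum.reindex) (auto simp: inj_on_def lpp_bd_left)
  have "measure_pmf.expectation (coins (bcells n m) q) (\<lambda>c. exp (y * lpp_bd c 0 z))
      \<le> exp (real (card ((\<lambda>k. (0::nat, k)) ` {1..z})) * b * (exp y - 1))"
    unfolding eq using ab assms by (intro mgf_coins_le) (auto simp: bcells_def q_def)
  also have "card ((\<lambda>k. (0::nat, k)) ` {1..z}) = z" by (subst card_image) (auto simp: inj_on_def)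
  finally show ?thesis .
qed

definition top_sum :: "nat \<Rightarrow> nat \<Rightarrow> (nat \<times> nat \<Rightarrow> bool) \<Rightarrow> nat" where
  "top_sum n m c = (\<Sum>i=1..n. of_bool (hinc c i m))"

lemma mgf_top:
  fixes y :: real
  shows "measure_pmf.expectation (coins (bcells n m) q) (\<lambda>c. exp (y * top_sum n m c))
    \<le> exp (real n * a * (exp y - 1))"
proof -
  let ?E = "(\<lambda>k. (k, 0::nat)) ` {1..n}"
  have eq: "real (top_sum n m c) = (\<Sum>e\<in>?E. of_bool (path_state n m 0 c e))" for c
    by (subst sum.reindex) (auto simp: inj_on_def top_sum_def path_state_def)
  have "measure_pmf.expectation (coins (bcells n m) q) (\<lambda>c. exp (y * top_sum n m c)) =
      measure_pmf.expectation (map_pmf (path_state n m 0) (coins (bcells n m) q))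
        (\<lambda>c. exp (y * (\<Sum>e\<in>?E. of_bool (c e))))"
    unfolding eq integral_map_pmf ..
  also have "\<dots> = measure_pmf.expectation (coins (bcells n m - {1..n} \<times> {1..m}) q)
        (\<lambda>c. exp (y * (\<Sum>e\<in>?E. of_bool (c e))))"
    by (subst map_path_state) auto
  also have "\<dots> \<le> exp (real (card ?E) * a * (exp y - 1))"
    using ab by (intro mgf_coins_le) (auto simp: bcells_def q_def)
  also have "card ?E = n" by (subst card_image) (auto simp: inj_on_def)
  finally show ?thesis .
qed

lemma lpp_bd_eq_left_plus_top: "lpp_bd c n m = lpp_bd c 0 m + top_sum n m c"
  unfolding top_sum_def by (rule lpp_bd_top)

text \<open>The left and the top sum are dependent, so the expectation of the product of their
  exponentials does not factorize. The inequality between arithmetic and geometric mean separates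
  them at the price of doubling \<open>y\<close>; to first order in \<open>y\<close> nothing is lost
  when the two means agree.\<close>

lemma mgf_lpp_bd_le:
  fixes y :: real
  shows "measure_pmf.expectation (coins (bcells n m) q) (\<lambda>c. exp (y * lpp_bd c n m))
    \<le> (exp (real n * a * (exp (2 * y) - 1)) + exp (real m * b * (exp (2 * y) - 1))) / 2"
proof -
  let ?E = "measure_pmf.expectation (coins (bcells n m) q)"
  have "?E (\<lambda>c. exp (y * lpp_bd c n m)) \<le>
      ?E (\<lambda>c. (exp (2 * y * top_sum n m c) + exp (2 * y * lpp_bd c 0 m)) / 2)"
  proof (intro integral_mono integrable_coins finite_bcells)
    fix c
    let ?u = "exp (y * top_sum n m c)" and ?v = "exp (y * lpp_bd c 0 m)"
    have "exp (y * lpp_bd c n m) = ?u * ?v"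
      unfolding lpp_bd_eq_left_plus_top[of c n m] exp_add[symmetric] by (simp add: algebra_simps)
    moreover have "exp (2 * y * top_sum n m c) = ?u\<^sup>2" "exp (2 * y * lpp_bd c 0 m) = ?v\<^sup>2"
      unfolding power2_eq_square exp_add[symmetric] by simp_all
    moreover have "?u * ?v \<le> (?u\<^sup>2 + ?v\<^sup>2) / 2" using sum_squares_bound[of ?u ?v] by simp
    ultimately show "exp (y * lpp_bd c n m)
        \<le> (exp (2 * y * top_sum n m c) + exp (2 * y * lpp_bd c 0 m)) / 2" by (simp only:)
  qed
  also have "\<dots> = (?E (\<lambda>c. exp (2 * y * top_sum n m c)) + ?E (\<lambda>c. exp (2 * y * lpp_bd c 0 m))) / 2"
    by simp
  also have "\<dots> \<le> (exp (real n * a * (exp (2 * y) - 1)) + exp (real m * b * (exp (2 * y) - 1))) / 2"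
    using mgf_top[of n m "2 * y"] mgf_left[of m m n "2 * y"] by simp
  finally show ?thesis .
qed

end

section \<open>Passage times of rectangles\<close>

lemma map_lpp_rect:
  assumes "finite S" "{s<..s+k} \<times> {t<..t+l} \<subseteq> S"
    and "\<And>e. e \<in> {s<..s+k} \<times> {t<..t+l} \<Longrightarrow> q e = p"
  shows "map_pmf (\<lambda>c. lpp c ({s<..s+k} \<times> {t<..t+l})) (coins S q) =
    map_pmf (\<lambda>c. lpp c ({0<..k} \<times> {0<..l})) (coins ({0<..k} \<times> {0<..l}) (\<lambda>_. p))"
proof -
  let ?R = "{s<..s+k} \<times> {t<..t+l}" and ?Q = "{0<..k} \<times> {0<..l}"
  let ?h = "\<lambda>(i, j). (i + s, j + t)"
  have im: "?R = ?h ` ?Q"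
  proof (intro equalityI subsetI)
    fix e assume "e \<in> ?R"
    hence "e = ?h (fst e - s, snd e - t)" "(fst e - s, snd e - t) \<in> ?Q" by auto
    thus "e \<in> ?h ` ?Q" by blast
  qed auto
  have "map_pmf (\<lambda>c. lpp c ?R) (coins S q) = map_pmf (\<lambda>c. lpp c ?R) (coins ?R (\<lambda>_. p))"
    using assms by (intro map_coins_subset) (auto intro: lpp_cong)
  also have "\<dots> = map_pmf (\<lambda>c. lpp (c \<circ> ?h) ?Q) (coins ?R (\<lambda>_. p))"
    unfolding im by (subst lpp_translate) auto
  also have "\<dots> = map_pmf (\<lambda>c. lpp c ?Q) (map_pmf (\<lambda>c. c \<circ> ?h) (coins ?R (\<lambda>_. p)))"
    by (simp add: pmf.map_comp o_def)
  also have "map_pmf (\<lambda>c. c \<circ> ?h) (coins ?R (\<lambda>_. p)) = coins ?Q (\<lambda>_. p)"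
    unfolding im by (rule Pi_pmf_bij_betw[symmetric]) (auto simp: bij_betw_def inj_on_def)
  finally show ?thesis .
qed

text \<open>The tilt \<open>sqrt (l / k)\<close> of the boundary densities balances the two boundary sums.\<close>

lemma mgf_lpp_rect:
  fixes y p :: real
  assumes "finite S" "{s<..s+k} \<times> {t<..t+l} \<subseteq> S" "0 < p" "p \<le> 1" "0 \<le> y"
    and "\<And>e. e \<in> {s<..s+k} \<times> {t<..t+l} \<Longrightarrow> q e = p"
  shows "measure_pmf.expectation (coins S q) (\<lambda>c. exp (y * lpp c ({s<..s+k} \<times> {t<..t+l})))
           \<le> exp (sqrt (p * k * l) * (exp (2 * y) - 1))"
proof (cases "k = 0 \<or> l = 0")
  case True
  thus ?thesis by (auto simp: lpp_def)
next
  case False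
  hence kl: "k > 0" "l > 0" by auto
  define s' where "s' = sqrt (real l / real k)"
  have s': "s' > 0" using kl by (simp add: s'_def)
  \<comment> \<open>In terms of the odds \<open>u = a / (1 - a)\<close> and
    \<open>v = b / (1 - b)\<close>, stationarity is the equation \<open>u * v = p\<close>. With the
    tilt, \<open>k * u\<close> and \<open>l * v\<close> both equal
    \<open>sqrt (p * k * l)\<close>.\<close>
  define u v where "u = s' * sqrt p" and "v = sqrt p / s'"
  have uv: "u > 0" "v > 0" "u * v = p" using s' assms by (auto simp: u_def v_def field_simps)
  define a b where "a = u / (1 + u)" and "b = v / (1 + v)"
  have a: "0 \<le> a" "a \<le> 1" "a \<le> u" and b: "0 \<le> b" "b \<le> 1" "b \<le> v"
    unfolding a_def b_def using uv(1,2) by (auto simp: divide_le_eq mult_le_cancel_left1)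
  have "1 - a = 1 / (1 + u)" "1 - b = 1 / (1 + v)"
    unfolding a_def b_def using uv(1,2) by (auto simp: field_simps)
  hence ab: "a * b = p * (1 - a) * (1 - b)"
    unfolding uv(3)[symmetric] by (simp add: a_def b_def)
  interpret burke a b p "\<lambda>e. if snd e = 0 then a else if fst e = 0 then b else p"
    by unfold_locales (use a b ab assms in auto)
  let ?q = "\<lambda>e. if snd e = 0 then a else if fst e = 0 then b else p"
  let ?R = "{0<..k} \<times> {0<..l}"
  have ka: "real k * a \<le> sqrt (p * k * l)"
  proof -
    have "real k * a \<le> real k * u" using a by (intro mult_left_mono) auto
    also have "\<dots> = sqrt (p * k * l)"
      using kl by (simp add: u_def v_def s'_def real_sqrt_mult real_sqrt_divide field_simps)
    finally show ?thesis .
  qed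
  have lb: "real l * b \<le> sqrt (p * k * l)"
  proof -
    have "real l * b \<le> real l * v" using b by (intro mult_left_mono) auto
    also have "\<dots> = sqrt (p * k * l)"
      using kl by (simp add: u_def v_def s'_def real_sqrt_mult real_sqrt_divide field_simps)
    finally show ?thesis .
  qed
  have e1: "exp (2 * y) - 1 \<ge> 0" using assms(5) by simp
  have m1: "map_pmf (\<lambda>c. lpp c ?R) (coins (bcells k l) ?q) =
      map_pmf (\<lambda>c. lpp c ?R) (coins ?R (\<lambda>_. p))"
    by (intro map_coins_subset) (auto simp: bcells_def intro: lpp_cong)
  have "measure_pmf.expectation (coins S q) (\<lambda>c. exp (y * lpp c ({s<..s+k} \<times> {t<..t+l}))) =
     measure_pmf.expectation (map_pmf (\<lambda>c. lpp c ({s<..s+k} \<times> {t<..t+l})) (coins S q)) (\<lambda>v. exp (y * v))"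
    by simp
  also have "\<dots> = measure_pmf.expectation (map_pmf (\<lambda>c. lpp c ?R) (coins (bcells k l) ?q)) (\<lambda>v. exp (y * v))"
    unfolding m1 using assms by (subst map_lpp_rect) auto
  also have "\<dots> = measure_pmf.expectation (coins (bcells k l) ?q) (\<lambda>c. exp (y * lpp c ?R))"
    by simp
  also have "\<dots> \<le> measure_pmf.expectation (coins (bcells k l) ?q) (\<lambda>c. exp (y * lpp_bd c k l))"
  proof (intro integral_mono integrable_coins finite_bcells)
    fix c
    have "lpp c ?R \<le> lpp_bd c k l"
      using lpp_le_lpp_bd[of c k l] by (simp add: atLeastSucAtMost_greaterThanAtMost)
    thus "exp (y * lpp c ?R) \<le> exp (y * lpp_bd c k l)"
      using assms(5) by (simp add: mult_left_mono)
  qed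
  also have "\<dots> \<le> (exp (real k * a * (exp (2 * y) - 1)) + exp (real l * b * (exp (2 * y) - 1))) / 2"
    by (rule mgf_lpp_bd_le)
  also have "\<dots> \<le> (exp (sqrt (p * k * l) * (exp (2 * y) - 1)) + exp (sqrt (p * k * l) * (exp (2 * y) - 1))) / 2"
    using mult_right_mono[OF ka e1] mult_right_mono[OF lb e1] by (intro divide_right_mono add_mono) auto
  finally show ?thesis by simp
qed

section \<open>Lower bound on squares\<close>

lemma exp_le_quadratic:
  fixes x :: real
  assumes "\<bar>x\<bar> \<le> 1"
  shows "exp x \<le> 1 + x + x\<^sup>2"
proof (cases "x \<ge> 0")
  case True
  thus ?thesis using exp_bound[of x] assms by simp
next
  case False
  define u where "u = - x"
  have u: "0 < u" "u \<le> 1" using False assms by (auto simp: u_def)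
  have "1 \<le> (1 - u + u\<^sup>2) * (1 + u)" using u by (simp add: algebra_simps power2_eq_square)
  also have "\<dots> \<le> (1 - u + u\<^sup>2) * exp u"
    using u by (intro mult_left_mono) auto
  finally have "exp (- u) \<le> 1 - u + u\<^sup>2" by (simp add: exp_minus field_simps)
  thus ?thesis by (simp add: u_def)
qed

text \<open>Stated from a moment bound rather than for sums of independent variables, so that it
  also covers half a passage time. Deviations are measured against a common \<open>N\<close> above
  all the means \<mu>, which gives every event of the later union bound the same exponent.\<close>

lemma chernoff_pmf_upper:
  fixes X :: "'a \<Rightarrow> real"
  assumes "finite (set_pmf M)" "0 \<le> \<mu>" "\<mu> \<le> N" "0 < \<eta>" "\<eta> \<le> 1"
    and "measure_pmf.expectation M (\<lambda>x. exp (\<eta> / 2 * X x)) \<le> exp (\<mu> * (exp (\<eta> / 2) - 1))"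
  shows "measure_pmf.prob M {x. X x \<ge> \<mu> + \<eta> * N} \<le> exp (- N * \<eta>\<^sup>2 / 4)"
proof -
  define t where "t = \<mu> + \<eta> * N"
  have "measure_pmf.prob M {x. X x \<ge> t} \<le>
      measure_pmf.expectation M (\<lambda>x. exp (- \<eta> / 2 * t) * exp (\<eta> / 2 * X x))"
    using assms by (intro prob_le_expectation_pmf) (auto simp flip: exp_add intro: mult_left_mono)
  also have "\<dots> = exp (- \<eta> / 2 * t) * measure_pmf.expectation M (\<lambda>x. exp (\<eta> / 2 * X x))"
    by simp
  also have "\<dots> \<le> exp (- \<eta> / 2 * t) * exp (\<mu> * (\<eta> / 2 + (\<eta> / 2)\<^sup>2))"
  proof (intro mult_left_mono order.trans[OF assms(6)])
    have "exp (\<eta> / 2) - 1 \<le> \<eta> / 2 + (\<eta> / 2)\<^sup>2"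
      using exp_le_quadratic[of "\<eta> / 2"] assms by auto
    thus "exp (\<mu> * (exp (\<eta> / 2) - 1)) \<le> exp (\<mu> * (\<eta> / 2 + (\<eta> / 2)\<^sup>2))"
      using assms by (simp add: mult_left_mono)
  qed auto
  also have "\<dots> = exp (\<mu> * (\<eta>\<^sup>2 / 4) - N * \<eta>\<^sup>2 / 2)"
    unfolding t_def exp_add[symmetric] by (simp add: field_simps power2_eq_square)
  also have "\<dots> \<le> exp (- N * \<eta>\<^sup>2 / 4)"
    using mult_right_mono[OF assms(3), of "\<eta>\<^sup>2 / 4"] by simp
  finally show ?thesis unfolding t_def .
qed

lemma chernoff_pmf_lower:
  fixes X :: "'a \<Rightarrow> real"
  assumes "finite (set_pmf M)" "0 \<le> \<mu>" "\<mu> \<le> N" "0 < \<eta>" "\<eta> \<le> 1"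
    and "measure_pmf.expectation M (\<lambda>x. exp (- \<eta> / 2 * X x)) \<le> exp (\<mu> * (exp (- \<eta> / 2) - 1))"
  shows "measure_pmf.prob M {x. X x \<le> \<mu> - \<eta> * N} \<le> exp (- N * \<eta>\<^sup>2 / 4)"
proof -
  define t where "t = \<mu> - \<eta> * N"
  have "measure_pmf.prob M {x. X x \<le> t} \<le>
      measure_pmf.expectation M (\<lambda>x. exp (\<eta> / 2 * t) * exp (- \<eta> / 2 * X x))"
    using assms by (intro prob_le_expectation_pmf) (auto simp flip: exp_add intro: mult_left_mono)
  also have "\<dots> = exp (\<eta> / 2 * t) * measure_pmf.expectation M (\<lambda>x. exp (- \<eta> / 2 * X x))"
    by simp
  also have "\<dots> \<le> exp (\<eta> / 2 * t) * exp (\<mu> * (- \<eta> / 2 + (- \<eta> / 2)\<^sup>2))"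
  proof (intro mult_left_mono order.trans[OF assms(6)])
    have "exp (- \<eta> / 2) - 1 \<le> - \<eta> / 2 + (- \<eta> / 2)\<^sup>2"
      using exp_le_quadratic[of "- \<eta> / 2"] assms by auto
    thus "exp (\<mu> * (exp (- \<eta> / 2) - 1)) \<le> exp (\<mu> * (- \<eta> / 2 + (- \<eta> / 2)\<^sup>2))"
      using assms by (simp add: mult_left_mono)
  qed auto
  also have "\<dots> = exp (\<mu> * (\<eta>\<^sup>2 / 4) - N * \<eta>\<^sup>2 / 2)"
    unfolding t_def exp_add[symmetric] by (simp add: field_simps power2_eq_square)
  also have "\<dots> \<le> exp (- N * \<eta>\<^sup>2 / 4)"
    using mult_right_mono[OF assms(3), of "\<eta>\<^sup>2 / 4"] by simp
  finally show ?thesis unfolding t_def .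
qed

text \<open>The quadratic term has to be kept: in the exit estimate the linear term exactly cancels
  what the boundary gains.\<close>

lemma sqrt_one_minus_le:
  fixes u :: real
  assumes "0 \<le> u" "u \<le> 1"
  shows "sqrt (1 - u) \<le> 1 - u / 2 - u\<^sup>2 / 8"
proof (rule real_le_lsqrt)
  have "u\<^sup>2 \<le> 1" using assms by (simp add: power_le_one)
  thus "0 \<le> 1 - u / 2 - u\<^sup>2 / 8" using assms by simp
  have "(1 - u / 2 - u\<^sup>2 / 8)\<^sup>2 = 1 - u + u ^ 3 / 8 + u ^ 4 / 64"
    by (simp add: field_simps power2_eq_square power3_eq_cube power4_eq_xxxx)
  moreover have "u ^ 3 \<ge> 0" "u ^ 4 \<ge> 0" using assms by auto
  ultimately show "1 - u \<le> (1 - u / 2 - u\<^sup>2 / 8)\<^sup>2" by linarith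
qed

text \<open>A far exit loses: with exit fraction \<open>u\<close> the boundary gains \<open>u\<close>, but the interior loses
  \<open>2 - 2 sqrt (1 - u) \<ge> u + u\<^sup>2 / 4\<close>.\<close>

lemma far_exit_deficit:
  fixes p \<eta> \<theta> \<rho> :: real and n z z' :: nat
  assumes "0 < p" "0 < n" "z \<le> n" "real z' \<le> real z + \<rho> * n" "\<theta> * n \<le> real z'"
    and "0 < \<theta>" "\<theta> \<le> 1" "0 < \<eta>" "0 < \<rho>" "\<rho> + 5 * \<eta> + 2 * sqrt p \<le> \<theta>\<^sup>2 / 16"
  shows "sqrt p * real z' + 2 * sqrt (p * (real n - real z) * n) + 3 * \<eta> * (n * sqrt p)
    \<le> 2 * (n * sqrt p) - 2 * sqrt p * (n * sqrt p) - 2 * \<eta> * (n * sqrt p)"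
proof -
  define N u where "N = n * sqrt p" and "u = z / n"
  have N: "N > 0" using assms by (simp add: N_def)
  have zu: "real z = u * n" using assms by (simp add: u_def)
  have u: "0 \<le> u" "u \<le> 1" using assms by (auto simp: u_def)
  \<comment> \<open>The grid spacing \<open>\<rho>\<close> is at most half of
    \<open>\<theta>\<close>, so already the lower grid point has exit fraction at least
    \<open>\<theta> / 2\<close>; this makes \<open>u^2 / 4\<close> at least the allowance
    \<open>\<theta>^2 / 16\<close>.\<close>
  have "\<theta>\<^sup>2 \<le> \<theta>" using assms by (simp add: power2_eq_square mult_left_le)
  hence "\<rho> \<le> \<theta> / 2" using assms(6,8,10) real_sqrt_ge_zero[of p] assms(1) by linarith
  moreover have "\<theta> * n \<le> (u + \<rho>) * n" using assms(4,5) by (simp add: zu algebra_simps)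
  hence "\<theta> \<le> u + \<rho>" using assms(2) by simp
  ultimately have "\<theta> / 2 \<le> u" by linarith
  hence "(\<theta> / 2)\<^sup>2 \<le> u\<^sup>2" using assms(6) by (intro power_mono) auto
  hence u2: "\<theta>\<^sup>2 / 16 \<le> u\<^sup>2 / 4" by (simp add: power_divide)
  have "sqrt (p * (real n - real z) * n) = sqrt (p * (n * n) * (1 - u))"
    by (rule arg_cong[where f = sqrt]) (simp add: zu algebra_simps)
  also have "\<dots> = N * sqrt (1 - u)" by (simp add: N_def real_sqrt_mult)
  also have "\<dots> \<le> N * (1 - u / 2 - u\<^sup>2 / 8)"
    using sqrt_one_minus_le[OF u] N by (intro mult_left_mono) auto
  finally have 1: "sqrt (p * (real n - real z) * n) \<le> N * (1 - u / 2 - u\<^sup>2 / 8)" .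
  have "sqrt p * real z' \<le> sqrt p * (u * n + \<rho> * n)"
    using assms by (intro mult_left_mono) (auto simp: zu)
  hence 2: "sqrt p * real z' \<le> N * (u + \<rho>)" by (simp add: N_def algebra_simps)
  have "N * (\<rho> + 5 * \<eta> + 2 * sqrt p) \<le> N * (u\<^sup>2 / 4)"
    using N u2 assms(10) by (intro mult_left_mono) auto
  with 1 2 show ?thesis unfolding N_def[symmetric] by (simp add: algebra_simps)
qed

context burke
begin

text \<open>With boundary, the passage time is very likely not much below \<open>2 * n * a\<close>,
  hence not much below \<open>2 * n * sqrt p\<close>. A path that exits far from the corner falls
  short of this value, and one that exits near it collects at most about a \<open>\<theta>\<close>
  fraction of \<open>n * sqrt p\<close> on the boundary, so the interior must supply the rest. Exit
  points are grouped into \<open>R\<close> grid intervals so that the number of events in the union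
  bound does not grow with \<open>n\<close>.\<close>

lemma prob_lpp_square_small:
  fixes \<eta> \<theta> :: real and n R :: nat
  assumes p: "0 < p" and sym: "b = a" "a = sqrt p / (1 + sqrt p)"
    and "0 < n" "0 < R" "0 < \<eta>" "\<eta> \<le> 1" "0 < \<theta>" "\<theta> \<le> 1"
    and par: "1 / R + 1 / n + 5 * \<eta> + 2 * sqrt p \<le> \<theta>\<^sup>2 / 16"
  shows "measure_pmf.prob (coins (bcells n n) q)
           {c. real (lpp c ({0<..n} \<times> {0<..n})) < (2 - 2 * \<theta>) * (n * sqrt p)}
         \<le> (4 * real R + 4) * exp (- (n * sqrt p) * \<eta>\<^sup>2 / 4)"
proof -
  let ?M = "coins (bcells n n) q"
  let ?P = "measure_pmf.prob ?M"
  define N where "N = n * sqrt p"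
  \<comment> \<open>The added 1 ensures \<open>n < R * d\<close>, so the grid points
    \<open>z 0, ..., z R\<close> enclose all exits in \<open>{0..n}\<close>; the minimum keeps them
    in the square.\<close>
  define d where "d = n div R + 1"
  define z where "z = (\<lambda>k. min (k * d) n)"
  let ?H = "\<lambda>k c. lpp c ({z k<..n} \<times> {0<..n})" and ?V = "\<lambda>k c. lpp c ({0<..n} \<times> {z k<..n})"
  have zn: "z k \<le> n" for k by (simp add: z_def)
  have fin: "finite (set_pmf ?M)" by (simp add: finite_set_coins)
  have a_le: "a \<le> sqrt p" "0 \<le> a"
    using p add_pos_pos[OF zero_less_one real_sqrt_gt_zero[OF p]] unfolding sym
    by (auto simp: divide_le_eq mult_le_cancel_left1)
  \<comment> \<open>The density \<open>a\<close> falls short of the odds \<open>sqrt p\<close> by at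
    most \<open>p\<close>. This is the source of the term \<open>2 * sqrt p\<close> in the smallness
    condition.\<close>
  have a_ge: "a \<ge> sqrt p - sqrt p * sqrt p"
  proof -
    have "(1 - sqrt p) * (1 + sqrt p) \<le> 1" using p by (simp add: algebra_simps)
    hence "1 - sqrt p \<le> 1 / (1 + sqrt p)" using p by (simp add: le_divide_eq add_pos_pos)
    hence "sqrt p * (1 - sqrt p) \<le> sqrt p * (1 / (1 + sqrt p))"
      using p by (intro mult_left_mono) auto
    thus ?thesis unfolding sym by (simp add: algebra_simps)
  qed
  define B where "B = exp (- N * \<eta>\<^sup>2 / 4)"
  have za: "real k * a \<le> N" if "k \<le> n" for k
    unfolding N_def using that a_le by (intro mult_mono) auto
  have nab: "0 \<le> real k * a" for k using a_le by simp
  have "0 \<le> N" by (simp add: N_def p less_imp_le)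

  define Bot where "Bot = (\<lambda>k. {c. real (lpp_bd c (z k) 0) \<ge> real (z k) * a + \<eta> * N})"
  define Lef where "Lef = (\<lambda>k. {c. real (lpp_bd c 0 (z k)) \<ge> real (z k) * a + \<eta> * N})"
  \<comment> \<open>Half the passage time appears because it is this variable to which
    \<open>mgf_lpp_rect\<close> gives a Poisson-type bound, with parameter
    \<open>sqrt (p * k * l)\<close> for sides \<open>k\<close> and \<open>l\<close>.\<close>
  define BH where "BH = (\<lambda>k. {c. real (?H k c) / 2 \<ge> sqrt (p * (real n - real (z k)) * n) + \<eta> * N})"
  define BV where "BV = (\<lambda>k. {c. real (?V k c) / 2 \<ge> sqrt (p * (real n - real (z k)) * n) + \<eta> * N})"
  define Top0 where "Top0 = {c. real (top_sum n n c) \<le> real n * a - \<eta> * N}"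
  define Lef0 where "Lef0 = {c. real (lpp_bd c 0 n) \<le> real n * a - \<eta> * N}"
  have pBot: "?P (Bot k) \<le> B" for k
    unfolding Bot_def B_def using assms mgf_bottom[of "z k" n n "\<eta> / 2"] zn[of k] za nab
    by (intro chernoff_pmf_upper fin) auto
  have pLef: "?P (Lef k) \<le> B" for k
    unfolding Lef_def B_def using assms mgf_left[of "z k" n n "\<eta> / 2"] zn[of k] za nab
    by (intro chernoff_pmf_upper fin) auto
  have pTop0: "?P Top0 \<le> B"
    unfolding Top0_def B_def using assms mgf_top[of n n "- \<eta> / 2"] za nab
    by (intro chernoff_pmf_lower fin) auto
  have pLef0: "?P Lef0 \<le> B"
    unfolding Lef0_def B_def using assms mgf_left[of n n n "- \<eta> / 2"] za nab
    by (intro chernoff_pmf_lower fin) auto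
  have sq: "0 \<le> sqrt (p * (real n - real (z k)) * n)" "sqrt (p * (real n - real (z k)) * n) \<le> N" for k
  proof -
    have "p * (real n - real (z k)) * n \<le> p * real n * real n"
      using p zn[of k] by (intro mult_right_mono mult_left_mono) auto
    hence "sqrt (p * (real n - real (z k)) * n) \<le> sqrt (p * real n * real n)" by simp
    also have "\<dots> = N" by (simp add: N_def real_sqrt_mult)
    finally show "sqrt (p * (real n - real (z k)) * n) \<le> N" .
    show "0 \<le> sqrt (p * (real n - real (z k)) * n)" using p zn[of k] by simp
  qed
  have pBH: "?P (BH k) \<le> B" for k
  proof -
    have "measure_pmf.expectation ?M (\<lambda>c. exp (\<eta> / 4 * lpp c ({z k<..z k + (n - z k)} \<times> {0<..0+n})))
        \<le> exp (sqrt (p * real (n - z k) * n) * (exp (2 * (\<eta> / 4)) - 1))"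
      using assms ab zn[of k] by (intro mgf_lpp_rect) (auto simp: bcells_def q_def)
    thus ?thesis unfolding BH_def B_def using assms sq[of k] zn[of k]
      by (intro chernoff_pmf_upper fin) (auto simp: of_nat_diff)
  qed
  have pBV: "?P (BV k) \<le> B" for k
  proof -
    have "measure_pmf.expectation ?M (\<lambda>c. exp (\<eta> / 4 * lpp c ({0<..0+n} \<times> {z k<..z k + (n - z k)})))
        \<le> exp (sqrt (p * n * real (n - z k)) * (exp (2 * (\<eta> / 4)) - 1))"
      using assms ab zn[of k] by (intro mgf_lpp_rect) (auto simp: bcells_def q_def)
    thus ?thesis unfolding BV_def B_def using assms sq[of k] zn[of k]
      by (intro chernoff_pmf_upper fin) (auto simp: of_nat_diff mult_ac)
  qed

  define \<rho> where "\<rho> = 1 / R + 1 / n"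
  have \<rho>: "\<rho> > 0" using assms by (simp add: \<rho>_def add_pos_pos)
  have d_le: "real d \<le> \<rho> * n"
  proof -
    have "real (n div R) \<le> real n / real R" by (rule of_nat_div_le_of_nat)
    thus ?thesis using assms by (simp add: d_def \<rho>_def algebra_simps)
  qed
  have far: "sqrt p * real (z (Suc k)) + 2 * sqrt (p * (real n - real (z k)) * n) + 3 * \<eta> * N
      \<le> 2 * (real n * a) - 2 * \<eta> * N" if "\<theta> * n < z (Suc k)" for k
  proof -
    have "z (Suc k) \<le> z k + d" unfolding z_def by (simp add: min_def)
    hence "real (z (Suc k)) \<le> real (z k) + real d" by linarith
    hence "sqrt p * real (z (Suc k)) + 2 * sqrt (p * (real n - real (z k)) * n) + 3 * \<eta> * (n * sqrt p)
      \<le> 2 * (n * sqrt p) - 2 * sqrt p * (n * sqrt p) - 2 * \<eta> * (n * sqrt p)"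
      using assms d_le zn \<rho> that par[folded \<rho>_def]
      by (intro far_exit_deficit[where \<rho> = \<rho> and \<theta> = \<theta>]) auto
    moreover have "2 * (n * sqrt p) - 2 * sqrt p * (n * sqrt p) =
        2 * (real n * (sqrt p - sqrt p * sqrt p))" by algebra
    hence "2 * (n * sqrt p) - 2 * sqrt p * (n * sqrt p) \<le> 2 * (real n * a)"
      using mult_left_mono[OF a_ge, of "real n"] by simp
    ultimately show ?thesis unfolding N_def by linarith
  qed
  have goal_ge: "(2 - 2 * \<theta>) * N \<le> 2 * (real n * a) - 2 * \<eta> * N - (\<theta> * N + \<eta> * N)"
  proof -
    have "\<theta>\<^sup>2 \<le> \<theta>" using assms by (simp add: power2_eq_square mult_left_le)
    hence "2 * sqrt p + 3 * \<eta> \<le> \<theta>"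
      using par[folded \<rho>_def] \<rho> assms by linarith
    hence "N * (2 * sqrt p + 3 * \<eta>) \<le> N * \<theta>" using \<open>0 \<le> N\<close> by (intro mult_left_mono)
    moreover have "N - sqrt p * N \<le> real n * a"
      using mult_left_mono[OF a_ge, of "real n"] by (simp add: algebra_simps N_def)
    ultimately show ?thesis by (simp add: algebra_simps)
  qed
  have near: "real (z (Suc k)) * a \<le> \<theta> * N" if "\<not> \<theta> * n < z (Suc k)" for k
    unfolding N_def mult.assoc[symmetric] using that a_le by (intro mult_mono) auto
  have za': "real (z k) * a \<le> sqrt p * real (z k)" for k
    using mult_left_mono[OF a_le(1), of "real (z k)"] by (simp add: mult.commute)

  let ?Bad = "Top0 \<union> Lef0 \<union> (\<Union>k\<le>R. Bot k) \<union> (\<Union>k\<le>R. Lef k) \<union> (\<Union>k<R. BH k) \<union> (\<Union>k<R. BV k)"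
  have "{c. real (lpp c ({0<..n} \<times> {0<..n})) < (2 - 2 * \<theta>) * N} \<subseteq> ?Bad"
  proof (rule subsetI, rule ccontr)
    fix c assume c: "c \<in> {c. real (lpp c ({0<..n} \<times> {0<..n})) < (2 - 2 * \<theta>) * N}" and nb: "c \<notin> ?Bad"
    have good: "real (top_sum n n c) > real n * a - \<eta> * N" "real (lpp_bd c 0 n) > real n * a - \<eta> * N"
      using nb by (auto simp: Top0_def Lef0_def)
    have goodk: "real (lpp_bd c (z k) 0) < real (z k) * a + \<eta> * N"
        "real (lpp_bd c 0 (z k)) < real (z k) * a + \<eta> * N" if "k \<le> R" for k
    proof -
      have "c \<notin> Bot k" "c \<notin> Lef k" using nb that by auto
      thus "real (lpp_bd c (z k) 0) < real (z k) * a + \<eta> * N"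
        "real (lpp_bd c 0 (z k)) < real (z k) * a + \<eta> * N" by (auto simp: Bot_def Lef_def)
    qed
    have goodL: "real (?H k c) / 2 < sqrt (p * (real n - real (z k)) * n) + \<eta> * N"
        "real (?V k c) / 2 < sqrt (p * (real n - real (z k)) * n) + \<eta> * N" if "k < R" for k
    proof -
      have "c \<notin> BH k" "c \<notin> BV k" using nb that by auto
      thus "real (?H k c) / 2 < sqrt (p * (real n - real (z k)) * n) + \<eta> * N"
        "real (?V k c) / 2 < sqrt (p * (real n - real (z k)) * n) + \<eta> * N"
        by (auto simp: BH_def BV_def)
    qed
    have G: "real (lpp_bd c n n) > 2 * (real n * a) - 2 * \<eta> * N"
      using good by (simp add: lpp_bd_eq_left_plus_top[of c n n])
    have split: "\<exists>k<R. z k \<le> w \<and> w \<le> z (Suc k)" if "w \<le> n" for w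
    proof (intro exI conjI)
      have "d > 0" by (simp add: d_def)
      have "n < R * d"
        unfolding d_def using assms(5) by (metis Suc_eq_plus1 dividend_less_times_div add.commute
            mult.commute mult_Suc)
      hence "w < R * d" using that by simp
      thus "w div d < R" by (simp add: less_mult_imp_div_less)
      show "z (w div d) \<le> w" by (simp add: z_def min.coboundedI1)
      show "w \<le> z (Suc (w div d))"
        using that dividend_less_div_times[OF \<open>d > 0\<close>, of w] by (simp add: z_def)
    qed
    have Lt: "real (lpp c ({0<..n} \<times> {0<..n})) < (2 - 2 * \<theta>) * N" using c by simp
    \<comment> \<open>The exit is rounded outwards: the boundary part \<open>S\<close> is taken up
      to the next grid point and the interior part \<open>LL\<close> from the previous one, so both
      only increase. A far exit cannot reach the value in \<open>G\<close>; a near one could do so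
      only if the square, which bounds \<open>LL\<close>, exceeded its assumed value.\<close>
    have fin_arg: False
      if k: "k < R" and S: "S < real (z (Suc k)) * a + \<eta> * N"
        and LL: "LL / 2 < sqrt (p * (real n - real (z k)) * n) + \<eta> * N"
        and "real (lpp_bd c n n) \<le> S + LL" and LL': "LL \<le> real (lpp c ({0<..n} \<times> {0<..n}))" for k S LL
    proof (cases "\<theta> * n < z (Suc k)")
      case True
      show False using far[OF True] that G za'[of "Suc k"] by linarith
    next
      case False
      show False using near[OF False] that G Lt goal_ge by linarith
    qed
    from lpp_bd_exit[of n c n] show False
    proof (elim disjE exE conjE)
      fix w assume w: "w \<le> n" "lpp_bd c n n \<le> lpp_bd c w 0 + lpp c ({w<..n} \<times> {0<..n})"
      obtain k where k: "k < R" "z k \<le> w" "w \<le> z (Suc k)" using split[OF w(1)] by blast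
      have "lpp_bd c w 0 \<le> lpp_bd c (z (Suc k)) 0"
        unfolding lpp_bd_bottom using k by (intro sum_mono2) auto
      moreover have "lpp c ({w<..n} \<times> {0<..n}) \<le> ?H k c" using k by (intro lpp_mono) auto
      moreover have "?H k c \<le> lpp c ({0<..n} \<times> {0<..n})" by (intro lpp_mono) auto
      ultimately show False
        using w(2) k(1) goodk(1)[of "Suc k"] goodL(1)[of k]
        by (intro fin_arg[of k "real (lpp_bd c (z (Suc k)) 0)" "real (?H k c)"]) auto
    next
      fix w assume w: "w \<le> n" "lpp_bd c n n \<le> lpp_bd c 0 w + lpp c ({0<..n} \<times> {w<..n})"
      obtain k where k: "k < R" "z k \<le> w" "w \<le> z (Suc k)" using split[OF w(1)] by blast
      have "lpp_bd c 0 w \<le> lpp_bd c 0 (z (Suc k))"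
        unfolding lpp_bd_left using k by (intro sum_mono2) auto
      moreover have "lpp c ({0<..n} \<times> {w<..n}) \<le> ?V k c" using k by (intro lpp_mono) auto
      moreover have "?V k c \<le> lpp c ({0<..n} \<times> {0<..n})" by (intro lpp_mono) auto
      ultimately show False
        using w(2) k(1) goodk(2)[of "Suc k"] goodL(2)[of k]
        by (intro fin_arg[of k "real (lpp_bd c 0 (z (Suc k)))" "real (?V k c)"]) auto
    qed
  qed
  hence "?P {c. real (lpp c ({0<..n} \<times> {0<..n})) < (2 - 2 * \<theta>) * N} \<le> ?P ?Bad"
    by (intro measure_pmf.finite_measure_mono) auto
  also have "\<dots> \<le> B + B + (real R + 1) * B + (real R + 1) * B + real R * B + real R * B"
  proof -
    have U1: "?P (\<Union>k\<le>R. E k) \<le> (real R + 1) * B" if "\<And>k. ?P (E k) \<le> B" for E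
    proof -
      have "?P (\<Union>k\<le>R. E k) \<le> (\<Sum>k\<le>R. ?P (E k))"
        by (rule measure_pmf.finite_measure_subadditive_finite) auto
      also have "\<dots> \<le> (\<Sum>k\<le>R. B)" by (intro sum_mono that)
      finally show ?thesis by (simp add: algebra_simps)
    qed
    have U2: "?P (\<Union>k<R. E k) \<le> real R * B" if "\<And>k. ?P (E k) \<le> B" for E
    proof -
      have "?P (\<Union>k<R. E k) \<le> (\<Sum>k<R. ?P (E k))"
        by (rule measure_pmf.finite_measure_subadditive_finite) auto
      also have "\<dots> \<le> (\<Sum>k<R. B)" by (intro sum_mono that)
      finally show ?thesis by simp
    qed
    have Un: "?P (E \<union> F) \<le> x + y" if "?P E \<le> x" "?P F \<le> y" for E F x y
      using measure_Un_le[of E ?M F] that by auto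
    show ?thesis
      by (intro Un U1 U2 pTop0 pLef0 pBot pLef pBH pBV)
  qed
  also have "\<dots> = (4 * real R + 4) * B" by (simp add: algebra_simps)
  finally show ?thesis unfolding N_def B_def .
qed

end

lemma prob_lpp_square_small_uniform:
  fixes \<epsilon> \<delta> :: real
  assumes "0 < \<epsilon>" "\<epsilon> \<le> 1" "0 < \<delta>"
  obtains K p0 :: real where "1 \<le> K" "0 < p0" "p0 \<le> 1"
    "\<And>(p::real) (n::nat). \<lbrakk>0 < p; p \<le> p0; K \<le> n * sqrt p\<rbrakk> \<Longrightarrow>
       measure_pmf.prob (coins ({0<..n} \<times> {0<..n}) (\<lambda>_. p))
         {c. real (lpp c ({0<..n} \<times> {0<..n})) < (1 - \<epsilon>) * 2 * (n * sqrt p)} \<le> \<delta>"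
proof -
  \<comment> \<open>The allowance \<open>\<epsilon>^2 / 16\<close> equals \<open>4 * h\<close>; the
    summands \<open>1 / R\<close>, \<open>1 / n\<close>, \<open>5 * \<eta>\<close> and
    \<open>2 * sqrt p\<close> each receive at most \<open>h\<close>.\<close>
  define h where "h = \<epsilon>\<^sup>2 / 64"
  have h: "0 < h" "h \<le> 1 / 64" using assms by (auto simp: h_def power_le_one)
  define R where "R = nat \<lceil>1 / h\<rceil>"
  have R: "R > 0" "1 / R \<le> h"
  proof -
    have "1 / h \<le> R" unfolding R_def by linarith
    moreover have "0 < 1 / h" using h by simp
    ultimately show "R > 0" by (auto intro: gr0I)
    with \<open>1 / h \<le> R\<close> h show "1 / R \<le> h" by (simp add: divide_le_eq mult.commute)
  qed
  define \<eta> where "\<eta> = h / 5"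
  have \<eta>: "0 < \<eta>" "\<eta> \<le> 1" using h by (auto simp: \<eta>_def)
  \<comment> \<open>From this size on, the exponential outweighs the number of bad events divided by
    \<delta>. Since \<open>R\<close> and \<open>\<eta>\<close> depend on \<epsilon> alone,
    \<open>K\<close> is independent of \<open>p\<close> and \<open>n\<close>.\<close>
  define K where "K = max 1 (4 / \<eta>\<^sup>2 * ln ((4 * real R + 4) / \<delta>))"
  define p0 where "p0 = (h / 2)\<^sup>2"
  show thesis
  proof (rule that)
    show "1 \<le> K" by (simp add: K_def)
    show "0 < p0" "p0 \<le> 1" using h by (auto simp: p0_def power_le_one)
    fix p :: real and n :: nat
    assume p: "0 < p" "p \<le> p0" and n: "K \<le> n * sqrt p"
    have sp: "sqrt p \<le> h / 2"
      using p h real_sqrt_le_mono[OF p(2)] by (simp add: p0_def)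
    have "1 \<le> n * sqrt p" using n by (simp add: K_def)
    hence n0: "n > 0" by (auto intro: gr0I)
    have p1: "p \<le> 1" using p h by (auto simp: p0_def power_le_one intro: order.trans)
    have "1 / n \<le> sqrt p" using n0 \<open>1 \<le> n * sqrt p\<close> by (simp add: field_simps)
    define a where "a = sqrt p / (1 + sqrt p)"
    have a1: "1 - a = 1 / (1 + sqrt p)" 
      unfolding a_def using add_pos_pos[OF zero_less_one real_sqrt_gt_zero[OF p(1)]]
      by (simp add: field_simps)
    interpret burke a a p "\<lambda>e. if snd e = 0 then a else if fst e = 0 then a else p"
    proof unfold_locales
      show "a * a = p * (1 - a) * (1 - a)" unfolding a1 using p by (simp add: a_def)
    qed (use p p1 in \<open>auto simp: a_def divide_le_eq add_pos_pos\<close>)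
    let ?q = "\<lambda>e. if snd e = 0 then a else if fst e = 0 then a else p"
    let ?R = "{0<..n} \<times> {0<..n}"
    have m: "map_pmf (\<lambda>c. lpp c ?R) (coins (bcells n n) ?q) = map_pmf (\<lambda>c. lpp c ?R) (coins ?R (\<lambda>_. p))"
      by (intro map_coins_subset) (auto simp: bcells_def intro: lpp_cong)
    let ?A = "{v. real v < (1 - \<epsilon>) * 2 * (n * sqrt p)}"
    have "measure_pmf.prob (coins ?R (\<lambda>_. p)) {c. real (lpp c ?R) < (1 - \<epsilon>) * 2 * (n * sqrt p)}
      = measure_pmf.prob (map_pmf (\<lambda>c. lpp c ?R) (coins ?R (\<lambda>_. p))) ?A"
      by (simp add: vimage_def)
    also have "\<dots> = measure_pmf.prob (coins (bcells n n) ?q)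
        {c. real (lpp c ?R) < (2 - 2 * \<epsilon>) * (n * sqrt p)}"
      unfolding m[symmetric] by (simp add: vimage_def algebra_simps)
    also have "\<dots> \<le> (4 * real R + 4) * exp (- (n * sqrt p) * \<eta>\<^sup>2 / 4)"
    proof (rule prob_lpp_square_small)
      show "1 / real R + 1 / real n + 5 * \<eta> + 2 * sqrt p \<le> \<epsilon>\<^sup>2 / 16"
        using R(2) \<open>1 / n \<le> sqrt p\<close> sp h(1) h_def unfolding \<eta>_def by linarith
    qed (use p n0 R \<eta> assms in \<open>auto simp: a_def\<close>)
    also have "\<dots> \<le> \<delta>"
    proof -
      have "4 / \<eta>\<^sup>2 * ln ((4 * real R + 4) / \<delta>) \<le> n * sqrt p" using n by (simp add: K_def)
      hence "ln ((4 * real R + 4) / \<delta>) \<le> (n * sqrt p) * \<eta>\<^sup>2 / 4" using \<eta> by (simp add: field_simps)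
      hence "(4 * real R + 4) / \<delta> \<le> exp ((n * sqrt p) * \<eta>\<^sup>2 / 4)"
        using assms by (metis (no_types, lifting) add_nonneg_pos divide_pos_pos exp_le_cancel_iff exp_ln mult_nonneg_nonneg of_nat_0_le_iff zero_less_numeral zero_le_numeral)
      thus ?thesis using assms by (simp add: exp_minus field_simps)
    qed
    finally show "measure_pmf.prob (coins ?R (\<lambda>_. p))
         {c. real (lpp c ?R) < (1 - \<epsilon>) * 2 * (n * sqrt p)} \<le> \<delta>" .
  qed
qed

section \<open>Lower tail by blocks\<close>

lemma expectation_pair_mult:
  fixes f :: "'a \<Rightarrow> real" and g :: "'b \<Rightarrow> real"
  assumes "finite (set_pmf A)" "finite (set_pmf B)"
  shows "measure_pmf.expectation (pair_pmf A B) (\<lambda>z. f (fst z) * g (snd z)) =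
    measure_pmf.expectation A f * measure_pmf.expectation B g"
proof -
  have "pair_pmf A B = A \<bind> (\<lambda>x. map_pmf (Pair x) B)"
    by (simp add: pair_pmf_def map_pmf_def)
  also have "measure_pmf.expectation \<dots> (\<lambda>z. f (fst z) * g (snd z)) =
      (\<Sum>x\<in>set_pmf A. pmf A x * (f x * measure_pmf.expectation B g))"
    using assms by (subst pmf_expectation_bind[of "set_pmf A"]) auto
  also have "\<dots> = (\<Sum>x\<in>set_pmf A. pmf A x * f x) * measure_pmf.expectation B g"
    by (simp add: sum_distrib_right mult.assoc)
  also have "(\<Sum>x\<in>set_pmf A. pmf A x * f x) = measure_pmf.expectation A f"
    using assms by (subst integral_measure_pmf[of "set_pmf A"]) auto
  finally show ?thesis .
qed

lemma expectation_prod_blocks: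
  fixes f :: "'i \<Rightarrow> (nat \<times> nat \<Rightarrow> bool) \<Rightarrow> real"
  assumes "finite I" "finite S" "\<And>i. i \<in> I \<Longrightarrow> T i \<subseteq> S" "disjoint_family_on T I"
    and "\<And>i c c'. \<lbrakk>i \<in> I; \<And>e. e \<in> T i \<Longrightarrow> c e = c' e\<rbrakk> \<Longrightarrow> f i c = f i c'"
  shows "measure_pmf.expectation (coins S q) (\<lambda>c. \<Prod>i\<in>I. f i c) =
    (\<Prod>i\<in>I. measure_pmf.expectation (coins S q) (f i))"
  using assms(1,3-)
proof (induction I rule: finite_induct)
  case (insert i I)
  have T: "T i \<subseteq> S" "finite (T i)" using insert.prems finite_subset[OF _ assms(2)] by auto
  let ?A = "coins (T i) q" and ?B = "coins (S - T i) q"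
  let ?m = "\<lambda>z e. if e \<in> T i then fst z e else snd z e"
  have S: "coins S q = map_pmf ?m (pair_pmf ?A ?B)"
    using T assms(2) Pi_pmf_union[of "T i" "S - T i" False "\<lambda>e. bernoulli_pmf (q e)"]
    by (simp add: Un_absorb1 case_prod_unfold)
  have fin: "finite (set_pmf ?A)" "finite (set_pmf ?B)"
    using T assms(2) by (auto intro: finite_set_coins)
  have 1: "f i (?m z) = f i (fst z)" for z
    by (rule insert.prems(3)) auto
  have 2: "(\<Prod>j\<in>I. f j (?m z)) = (\<Prod>j\<in>I. f j (snd z))" for z
  proof -
    have "f j (?m z) = f j (snd z)" if j: "j \<in> I" for j
    proof (rule insert.prems(3))
      show "j \<in> insert i I" using j by simp
      fix e assume "e \<in> T j"
      moreover have "T i \<inter> T j = {}"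
        using insert.hyps(2) j by (intro disjoint_family_onD[OF insert.prems(2)]) auto
      ultimately show "(if e \<in> T i then fst z e else snd z e) = snd z e" by auto
    qed
    thus ?thesis by simp
  qed
  have E1: "measure_pmf.expectation (coins S q) (f i) = measure_pmf.expectation ?A (f i)"
    unfolding S integral_map_pmf 1 by simp
  have E2: "measure_pmf.expectation (coins S q) (\<lambda>c. \<Prod>j\<in>I. f j c) =
      measure_pmf.expectation ?B (\<lambda>c. \<Prod>j\<in>I. f j c)"
    unfolding S integral_map_pmf 2
    by (rule expectation_pair_pmf_snd[where f = "\<lambda>c. \<Prod>j\<in>I. f j c"])
  have "measure_pmf.expectation (coins S q) (\<lambda>c. \<Prod>j\<in>insert i I. f j c) =
      measure_pmf.expectation (coins S q) (\<lambda>c. f i c * (\<Prod>j\<in>I. f j c))"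
    using insert.hyps by simp
  also have "\<dots> = measure_pmf.expectation (coins S q) (f i) *
      measure_pmf.expectation (coins S q) (\<lambda>c. \<Prod>j\<in>I. f j c)"
    unfolding E1 E2 unfolding S integral_map_pmf 1 2 by (rule expectation_pair_mult[OF fin])
  also have "measure_pmf.expectation (coins S q) (\<lambda>c. \<Prod>j\<in>I. f j c) =
      (\<Prod>j\<in>I. measure_pmf.expectation (coins S q) (f j))"
  proof (rule insert.IH)
    show "disjoint_family_on T I"
      using insert.prems(2) by (simp add: disjoint_family_on_def)
  qed (use insert.prems(1) insert.prems(3) in blast)+
  finally show ?case using insert.hyps by simp
qed simp

text \<open>Tilting by the full rate \<open>s\<close> costs at most a factor 2 per block, since
  \<open>exp s * exp (- s) = 1\<close>, however large \<open>s\<close> is. Thus rarer bad blocks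
  improve the exponent while the entropy term \<open>card I\<close> stays the same.\<close>

lemma prob_many_bad_blocks:
  fixes s r :: real
  assumes "finite I" "finite S" "\<And>i. i \<in> I \<Longrightarrow> T i \<subseteq> S" "disjoint_family_on T I" "0 \<le> s"
    and "\<And>i c c'. \<lbrakk>i \<in> I; \<And>e. e \<in> T i \<Longrightarrow> c e = c' e\<rbrakk> \<Longrightarrow> A i c = A i c'"
    and "\<And>i. i \<in> I \<Longrightarrow> measure_pmf.prob (coins S q) {c. A i c} \<le> exp (- s)"
  shows "measure_pmf.prob (coins S q) {c. (\<Sum>i\<in>I. of_bool (A i c)) \<ge> r} \<le> exp (card I - s * r)"
proof -
  let ?E = "measure_pmf.expectation (coins S q)"
  have factor: "?E (\<lambda>c. exp (s * of_bool (A i c))) \<le> exp 1" if "i \<in> I" for i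
  proof -
    have "?E (\<lambda>c. exp (s * of_bool (A i c))) = ?E (\<lambda>c. 1 + (exp s - 1) * indicator {c. A i c} c)"
      by (intro integral_cong_AE) (auto simp: indicator_def)
    also have "\<dots> = 1 + (exp s - 1) * measure_pmf.prob (coins S q) {c. A i c}"
      using assms(2) by simp
    also have "\<dots> \<le> 1 + (exp s - 1) * exp (- s)"
      using assms(5,7) that by (intro add_left_mono mult_left_mono) auto
    also have "\<dots> \<le> 1 + 1" by (simp add: algebra_simps exp_minus)
    also have "\<dots> \<le> exp 1" using exp_ge_add_one_self[of 1] by simp
    finally show ?thesis .
  qed
  have "measure_pmf.prob (coins S q) {c. (\<Sum>i\<in>I. of_bool (A i c)) \<ge> r} \<le>
      ?E (\<lambda>c. exp (- s * r) * (\<Prod>i\<in>I. exp (s * of_bool (A i c))))"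
  proof (intro prob_le_expectation_pmf finite_set_coins assms(2))
    fix c assume "c \<in> {c. (\<Sum>i\<in>I. of_bool (A i c)) \<ge> r}"
    hence "0 \<le> - s * r + s * (\<Sum>i\<in>I. of_bool (A i c))"
      using mult_left_mono[OF _ assms(5)] by simp
    hence "1 \<le> exp (- s * r + s * (\<Sum>i\<in>I. of_bool (A i c)))" by (simp only: one_le_exp_iff)
    also have "\<dots> = exp (- s * r) * (\<Prod>i\<in>I. exp (s * of_bool (A i c)))"
      unfolding exp_add sum_distrib_left exp_sum[OF assms(1)] ..
    finally show "1 \<le> exp (- s * r) * (\<Prod>i\<in>I. exp (s * of_bool (A i c)))" .
  qed (auto intro!: mult_nonneg_nonneg prod_nonneg)
  also have "\<dots> = exp (- s * r) * (\<Prod>i\<in>I. ?E (\<lambda>c. exp (s * of_bool (A i c))))"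
  proof -
    have "?E (\<lambda>c. \<Prod>i\<in>I. exp (s * of_bool (A i c))) = (\<Prod>i\<in>I. ?E (\<lambda>c. exp (s * of_bool (A i c))))"
    proof (rule expectation_prod_blocks[where T = T, OF assms(1-4)])
      fix i :: 'a and c c' :: "nat \<times> nat \<Rightarrow> bool"
      assume "i \<in> I" "\<And>e. e \<in> T i \<Longrightarrow> c e = c' e"
      hence "A i c = A i c'" by (rule assms(6))
      thus "exp (s * of_bool (A i c)) = exp (s * of_bool (A i c'))" by simp
    qed
    thus ?thesis by simp
  qed
  also have "\<dots> \<le> exp (- s * r) * (\<Prod>i\<in>I. exp 1)"
    using factor by (intro mult_left_mono prod_mono conjI integral_nonneg_AE) auto
  also have "\<dots> = exp (card I - s * r)"
    by (simp add: exp_diff exp_minus field_simps flip: exp_of_nat_mult)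
  finally show ?thesis .
qed

section \<open>Blocks above the diagonal\<close>

definition block :: "nat \<Rightarrow> nat \<times> nat \<Rightarrow> (nat \<times> nat) set" where
  "block B = (\<lambda>(k, j). {k * B<..k * B + B} \<times> {(k + j) * B<..(k + j) * B + B})"

lemma interval_index_unique:
  fixes x k l B :: nat
  assumes "x \<in> {k * B<..k * B + B}" "x \<in> {l * B<..l * B + B}"
  shows "k = l"
proof (rule ccontr)
  assume "k \<noteq> l"
  hence "Suc k \<le> l \<or> Suc l \<le> k" by linarith
  hence "Suc k * B \<le> l * B \<or> Suc l * B \<le> k * B" using mult_le_mono1 by blast
  thus False using assms by auto
qed

lemma disjoint_blocks: "disjoint_family_on (block B) I"
  unfolding disjoint_family_on_def
proof (intro ballI impI)
  fix x y :: "nat \<times> nat" assume "x \<noteq> y"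
  obtain k j where x: "x = (k, j)" by fastforce
  obtain l i where y: "y = (l, i)" by fastforce
  show "block B x \<inter> block B y = {}"
  proof (rule ccontr)
    assume "block B x \<inter> block B y \<noteq> {}"
    then obtain u v where "(u, v) \<in> block B x" "(u, v) \<in> block B y" by fastforce
    hence "k = l" "k + j = l + i"
      unfolding x y block_def by (auto intro: interval_index_unique[of u] interval_index_unique[of v])
    thus False using \<open>x \<noteq> y\<close> by (simp add: x y)
  qed
qed

lemma block_subset_triangle:
  assumes "(m + J) * B \<le> n" "k < m" "1 \<le> j" "j \<le> J"
  shows "block B (k, j) \<subseteq> upper_triangle n"
proof
  fix e assume "e \<in> block B (k, j)"
  then obtain x y where e: "e = (x, y)" "k * B < x" "x \<le> k * B + B" "(k + j) * B < y"
    "y \<le> (k + j) * B + B" by (auto simp: block_def)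
  have "Suc k * B \<le> (k + j) * B" using assms by (intro mult_le_mono1) auto
  hence "x < y" using e by simp
  have "Suc (k + j) * B \<le> (m + J) * B" using assms by (intro mult_le_mono1) auto
  hence "y \<le> n" using e assms(1) by simp
  with \<open>x < y\<close> show "e \<in> upper_triangle n" using e(1,2) by (auto simp: upper_triangle_def)
qed

lemma strip_sum_le_lpp_triangle:
  assumes "(m + J) * B \<le> n" "1 \<le> j" "j \<le> J"
  shows "(\<Sum>k<m. lpp c (block B (k, j))) \<le> lpp c (upper_triangle n)"
proof -
  have fin: "finite (block B (k, j))" for k by (simp add: block_def)
  have "(\<Sum>k<m. lpp c (block B (k, j))) \<le> L (\<Union>k<m. {e \<in> block B (k, j). c e})"
    unfolding lpp_def
  proof (rule sum_L_le_L_UN)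
    fix k l e f assume kl: "k < l" "l < m"
      and ef: "e \<in> {e \<in> block B (k, j). c e}" "f \<in> {e \<in> block B (l, j). c e}"
    have "Suc k * B \<le> l * B" "Suc (k + j) * B \<le> (l + j) * B"
      using kl by (intro mult_le_mono1; simp)+
    thus "strictly_below e f" using ef by (auto simp: block_def strictly_below_def)
  qed (simp add: fin)
  also have "\<dots> \<le> lpp c (upper_triangle n)"
    unfolding lpp_def
    using block_subset_triangle[OF assms(1) _ assms(2,3)]
    by (intro L_mono finite_subset[OF Collect_restrict finite_triangle]) blast
  finally show ?thesis .
qed

text \<open>In the row of blocks of one offset every good block adds at least \<open>t\<close>, so
  the assumed passage time leaves room for at most \<open>(1 - e) * m\<close> good ones. One and the
  same passage time bounds all \<open>J\<close> rows, so the counts of bad blocks add up.\<close>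

lemma many_bad_blocks:
  fixes t e :: real
  assumes "(m + J) * B \<le> n" "0 < t" "real (lpp c (upper_triangle n)) \<le> t * (1 - e) * m"
  shows "e * m * J \<le> (\<Sum>i\<in>{..<m} \<times> {1..J}. of_bool (real (lpp c (block B i)) < t))"
proof -
  have strip: "e * m \<le> (\<Sum>k<m. of_bool (real (lpp c (block B (k, j))) < t))" if "j \<in> {1..J}" for j
  proof -
    have "t * (\<Sum>k<m. 1 - of_bool (real (lpp c (block B (k, j))) < t)) \<le>
        (\<Sum>k<m. real (lpp c (block B (k, j))))"
      unfolding sum_distrib_left by (intro sum_mono) auto
    also have "\<dots> \<le> t * (1 - e) * m"
      using strip_sum_le_lpp_triangle[OF assms(1), of j c] that assms(3)
      by (simp flip: of_nat_sum)
    finally have "t * (\<Sum>k<m. 1 - of_bool (real (lpp c (block B (k, j))) < t)) \<le> t * ((1 - e) * m)"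
      by (simp add: mult.assoc)
    hence "(\<Sum>k<m. 1 - of_bool (real (lpp c (block B (k, j))) < t)) \<le> (1 - e) * m"
      using assms(2) by (simp only: mult_le_cancel_left_pos)
    thus ?thesis unfolding sum_subtractf by (simp add: algebra_simps)
  qed
  have "e * m * J = (\<Sum>j=1..J. e * m)" by simp
  also have "\<dots> \<le> (\<Sum>j=1..J. \<Sum>k<m. of_bool (real (lpp c (block B (k, j))) < t))"
    by (intro sum_mono strip)
  also have "\<dots> = (\<Sum>k<m. \<Sum>j=1..J. of_bool (real (lpp c (block B (k, j))) < t))"
    by (rule sum.swap)
  also have "\<dots> = (\<Sum>i\<in>{..<m} \<times> {1..J}. of_bool (real (lpp c (block B i)) < t))"
    unfolding sum.cartesian_product by (intro sum.cong) auto
  finally show ?thesis .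
qed

text \<open>The rate \<open>D\<close> is prescribed in advance: it enters only through the number
  \<open>J\<close> of offsets, and hence through \<open>A\<close>.\<close>

lemma lower_tail_triangle:
  fixes \<epsilon> D :: real
  assumes "0 < \<epsilon>" "\<epsilon> \<le> 1" "0 < D"
  obtains A p0 :: real where "0 < p0" "p0 \<le> 1"
    "\<And>(p::real) (n::nat). \<lbrakk>0 < p; p \<le> p0; A \<le> n * sqrt p\<rbrakk> \<Longrightarrow>
       measure_pmf.prob (coins (upper_triangle n) (\<lambda>_. p))
         {c. real (lpp c (upper_triangle n)) \<le> (1 - \<epsilon>) * 2 * (n * sqrt p)} \<le> exp (- D * (n * sqrt p))"
proof -
  \<comment> \<open>Three factors \<open>1 - e\<close> are lost: in the level of a single block, in
    the fraction of good blocks, and in the part of the side \<open>n\<close> that the blocks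
    cover.\<close>
  define e where "e = \<epsilon> / 4"
  have e: "0 < e" "e \<le> 1 / 4" using assms by (auto simp: e_def)
  \<comment> \<open>Chosen so that the exponent \<open>card I - s * (e * m * J)\<close> with
    \<open>card I = m * J\<close> becomes \<open>- m * J\<close>.\<close>
  define s where "s = 2 / e"
  have s: "0 \<le> s" "s * e = 2" using e by (auto simp: s_def)
  have "e \<le> 1" using e by simp
  then obtain K p0 :: real where Kp: "1 \<le> K" "0 < p0" "p0 \<le> 1"
    "\<And>(p::real) (n::nat). \<lbrakk>0 < p; p \<le> p0; K \<le> n * sqrt p\<rbrakk> \<Longrightarrow>
       measure_pmf.prob (coins ({0<..n} \<times> {0<..n}) (\<lambda>_. p))
         {c. real (lpp c ({0<..n} \<times> {0<..n})) < (1 - e) * 2 * (n * sqrt p)} \<le> exp (- s)"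
    using prob_lpp_square_small_uniform[of e "exp (- s)"] e by (metis exp_gt_zero)
  \<comment> \<open>As \<open>m * (K + 1)\<close> will be at least half of
    \<open>n * sqrt p\<close>, this many offsets make \<open>m * J\<close> at least
    \<open>D * (n * sqrt p)\<close>.\<close>
  define J where "J = nat \<lceil>2 * (K + 1) * D\<rceil>"
  have J: "2 * (K + 1) * D \<le> J" unfolding J_def by linarith
  \<comment> \<open>Makes the at most \<open>J + 1\<close> intervals lost to the offsets and to
    rounding no more than a fraction \<open>e\<close> of \<open>n\<close>.\<close>
  define A where "A = (real J + 1) * (K + 1) / e"
  show thesis
  proof (rule that[OF Kp(2,3)])
    fix p :: real and n :: nat
    assume p: "0 < p" "p \<le> p0" and n: "A \<le> n * sqrt p"
    have sp: "0 < sqrt p" "sqrt p \<le> 1" using p Kp by auto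
    \<comment> \<open>Then \<open>B * sqrt p\<close> lies between \<open>K\<close> and
      \<open>K + 1\<close>: large enough for the estimate on squares, and bounded independently of
      \<open>p\<close>.\<close>
    define B where "B = nat \<lceil>K / sqrt p\<rceil>"
    have "K / sqrt p \<le> B" unfolding B_def by linarith
    hence BK: "K \<le> B * sqrt p" using sp by (simp add: divide_le_eq)
    have "real B \<le> K / sqrt p + 1" unfolding B_def using Kp sp by (simp add: of_nat_nat)
    hence "B * sqrt p \<le> (K / sqrt p + 1) * sqrt p" using sp by (intro mult_right_mono) auto
    also have "\<dots> = K + sqrt p" using sp by (simp add: field_simps)
    finally have BK1: "B * sqrt p \<le> K + 1" using sp by linarith
    have B0: "B > 0" using BK Kp(1) by (auto intro: gr0I)
    have nB: "(real J + 1) * B \<le> e * n"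
    proof -
      have "(real J + 1) * (B * sqrt p) \<le> (real J + 1) * (K + 1)"
        using BK1 by (intro mult_left_mono) auto
      also have "\<dots> \<le> e * (n * sqrt p)" using n e by (simp add: A_def divide_le_eq mult.commute)
      finally have "((real J + 1) * B) * sqrt p \<le> (e * n) * sqrt p" by (simp add: mult.assoc)
      thus ?thesis using sp by simp
    qed
    have "e * n \<le> n" using e by (simp add: mult_left_le_one_le)
    hence "real ((J + 1) * B) \<le> real n" using nB by (simp add: algebra_simps)
    hence "(J + 1) * B \<le> n" by (simp only: of_nat_le_iff)
    hence Jn: "J + 1 \<le> n div B" using B0 by (simp add: less_eq_div_iff_mult_less_eq)
    define m where "m = n div B - J"
    have mJ: "m + J = n div B" using Jn by (simp add: m_def)
    have mJB: "(m + J) * B \<le> n" unfolding mJ by simp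
    have "n < (n div B + 1) * B"
      using dividend_less_div_times[OF B0, of n] by simp
    hence "real n < real ((m + J + 1) * B)" unfolding mJ by (simp only: of_nat_less_iff)
    hence "real n < real m * B + (real J + 1) * B" by (simp add: algebra_simps)
    hence mB: "(1 - e) * n \<le> real m * B" using nB by (simp add: algebra_simps)
    define t where "t = (1 - e) * 2 * (B * sqrt p)"
    have t: "t > 0" unfolding t_def using e B0 sp by simp
    let ?I = "{..<m} \<times> {1..J}"
    have level: "(1 - \<epsilon>) * 2 * (n * sqrt p) \<le> t * (1 - e) * m"
    proof -
      have "1 - \<epsilon> \<le> (1 - e) * (1 - e) * (1 - e)"
      proof -
        have "(1 - e) * (1 - e) * (1 - e) = 1 - 4 * e + e * (1 + e * (3 - e))" by (simp add: algebra_simps)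
        moreover have "0 \<le> e * (1 + e * (3 - e))" using e by simp
        ultimately show ?thesis by (simp add: e_def)
      qed
      hence "(1 - \<epsilon>) * (2 * (n * sqrt p)) \<le> (1 - e) * (1 - e) * (1 - e) * (2 * (n * sqrt p))"
        using sp by (intro mult_right_mono) auto
      also have "\<dots> = (1 - e) * (1 - e) * 2 * sqrt p * ((1 - e) * n)" by simp
      also have "\<dots> \<le> (1 - e) * (1 - e) * 2 * sqrt p * (real m * B)"
        using e sp by (intro mult_left_mono[OF mB]) auto
      also have "\<dots> = t * (1 - e) * m" by (simp add: t_def)
      finally show ?thesis by (simp only: mult.assoc)
    qed
    have "measure_pmf.prob (coins (upper_triangle n) (\<lambda>_. p))
         {c. real (lpp c (upper_triangle n)) \<le> (1 - \<epsilon>) * 2 * (n * sqrt p)} \<le>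
      measure_pmf.prob (coins (upper_triangle n) (\<lambda>_. p))
         {c. (\<Sum>i\<in>?I. of_bool (real (lpp c (block B i)) < t)) \<ge> e * m * J}"
      using many_bad_blocks[OF mJB t] level
      by (intro measure_pmf.finite_measure_mono) (auto intro: order.trans)
    also have "\<dots> \<le> exp (card ?I - s * (e * m * J))"
    proof (rule prob_many_bad_blocks[where T = "block B"])
      fix i assume i: "i \<in> ?I"
      then obtain k j where kj: "i = (k, j)" "k < m" "1 \<le> j" "j \<le> J" by auto
      show sub: "block B i \<subseteq> upper_triangle n"
        using block_subset_triangle[OF mJB] kj by simp
      have "map_pmf (\<lambda>c. lpp c (block B i)) (coins (upper_triangle n) (\<lambda>_. p)) =
          map_pmf (\<lambda>c. lpp c ({0<..B} \<times> {0<..B})) (coins ({0<..B} \<times> {0<..B}) (\<lambda>_. p))"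
        using sub unfolding kj(1) block_def prod.case by (intro map_lpp_rect) auto
      hence "measure_pmf.prob (map_pmf (\<lambda>c. lpp c (block B i)) (coins (upper_triangle n) (\<lambda>_. p))) {v. real v < t} =
        measure_pmf.prob (map_pmf (\<lambda>c. lpp c ({0<..B} \<times> {0<..B})) (coins ({0<..B} \<times> {0<..B}) (\<lambda>_. p))) {v. real v < t}"
        by simp
      thus "measure_pmf.prob (coins (upper_triangle n) (\<lambda>_. p)) {c. real (lpp c (block B i)) < t} \<le> exp (- s)"
        using Kp(4)[OF p BK] by (simp add: vimage_def t_def)
    next
      fix i and c c' :: "nat \<times> nat \<Rightarrow> bool"
      assume "\<And>e. e \<in> block B i \<Longrightarrow> c e = c' e"
      hence "lpp c (block B i) = lpp c' (block B i)" by (rule lpp_cong)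
      thus "(real (lpp c (block B i)) < t) = (real (lpp c' (block B i)) < t)" by simp
    qed (use s disjoint_blocks in auto)
    also have "\<dots> \<le> exp (- D * (n * sqrt p))"
    proof -
      have "s * (e * m * J) = 2 * (real m * J)" using s(2) by (simp flip: mult.assoc)
      moreover have "D * (n * sqrt p) \<le> real m * J"
      proof -
        have "1 / 2 * (n * sqrt p) \<le> (1 - e) * (n * sqrt p)"
          using e sp by (intro mult_right_mono) auto
        hence "(n * sqrt p) / 2 \<le> (1 - e) * n * sqrt p" by (simp add: mult.assoc)
        also have "\<dots> \<le> real m * B * sqrt p" using mB sp by (intro mult_right_mono) auto
        also have "\<dots> \<le> real m * (K + 1)" using BK1 by (simp add: mult.assoc mult_left_mono)
        finally have "(n * sqrt p) / 2 * (2 * D) \<le> real m * (K + 1) * (2 * D)"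
          using assms(3) by (intro mult_right_mono) auto
        hence "D * (n * sqrt p) \<le> real m * (2 * (K + 1) * D)" by (simp add: algebra_simps)
        also have "\<dots> \<le> real m * J" using J by (intro mult_left_mono) auto
        finally show ?thesis .
      qed
      moreover have "real (card ?I) = real m * J" by simp
      ultimately have "real (card ?I) - s * (e * m * J) \<le> - D * (n * sqrt p)" by linarith
      thus ?thesis by (simp only: exp_le_cancel_iff)
    qed
    finally show "measure_pmf.prob (coins (upper_triangle n) (\<lambda>_. p))
         {c. real (lpp c (upper_triangle n)) \<le> (1 - \<epsilon>) * 2 * (n * sqrt p)} \<le> exp (- D * (n * sqrt p))" .
  qed
qed

section \<open>The symmetric model\<close>

lemma sym_bigraph_pmf_eq:
  "sym_bigraph_pmf n p = map_pmf (\<lambda>c. {(i, j) \<in> complete_bigraph n.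
     (i < j \<and> c (i, j)) \<or> (j < i \<and> c (j, i))}) (coins (upper_triangle n) (\<lambda>_. p))"
  unfolding sym_bigraph_pmf_def upper_triangle_def ..

lemma expectation_sym_bigraph:
  fixes f :: "nat \<Rightarrow> real"
  shows "measure_pmf.expectation (sym_bigraph_pmf n p) (\<lambda>G. f (L G)) =
    measure_pmf.expectation (coins (upper_triangle n) (\<lambda>_. p)) (\<lambda>c. f (lpp c (upper_triangle n)))"
  unfolding sym_bigraph_pmf_eq integral_map_pmf L_symmetric_eq_lpp_triangle ..

lemma prob_sym_bigraph:
  "measure_pmf.prob (sym_bigraph_pmf n p) {G. P (L G)} =
    measure_pmf.prob (coins (upper_triangle n) (\<lambda>_. p)) {c. P (lpp c (upper_triangle n))}"
  unfolding sym_bigraph_pmf_eq measure_map_pmf vimage_def mem_Collect_eq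
    L_symmetric_eq_lpp_triangle ..

section \<open>Upper tail and expectation for the triangle\<close>

lemma mgf_triangle:
  fixes p y :: real
  assumes "0 < p" "p \<le> 1" "0 \<le> y"
  shows "measure_pmf.expectation (coins (upper_triangle n) (\<lambda>_. p)) (\<lambda>c. exp (y * lpp c (upper_triangle n)))
    \<le> exp ((n * sqrt p) * (exp (2 * y) - 1))"
proof -
  let ?Q = "{0<..0+n} \<times> {0<..0+n}"
  have sub: "upper_triangle n \<subseteq> ?Q" by (auto simp: upper_triangle_def)
  have m: "map_pmf (\<lambda>c. lpp c (upper_triangle n)) (coins ?Q (\<lambda>_. p)) =
      map_pmf (\<lambda>c. lpp c (upper_triangle n)) (coins (upper_triangle n) (\<lambda>_. p))"
    using sub by (intro map_coins_subset) (auto intro: lpp_cong)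
  have "measure_pmf.expectation (coins (upper_triangle n) (\<lambda>_. p)) (\<lambda>c. exp (y * lpp c (upper_triangle n))) =
      measure_pmf.expectation (map_pmf (\<lambda>c. lpp c (upper_triangle n)) (coins (upper_triangle n) (\<lambda>_. p)))
        (\<lambda>v. exp (y * v))" by simp
  also have "\<dots> = measure_pmf.expectation (coins ?Q (\<lambda>_. p)) (\<lambda>c. exp (y * lpp c (upper_triangle n)))"
    unfolding m[symmetric] by simp
  also have "\<dots> \<le> measure_pmf.expectation (coins ?Q (\<lambda>_. p)) (\<lambda>c. exp (y * lpp c ?Q))"
  proof (intro integral_mono integrable_coins)
    fix c
    have "lpp c (upper_triangle n) \<le> lpp c ?Q" using sub by (intro lpp_mono) auto
    thus "exp (y * lpp c (upper_triangle n)) \<le> exp (y * lpp c ?Q)"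
      using assms(3) by (simp add: mult_left_mono)
  qed auto
  also have "\<dots> \<le> exp (sqrt (p * n * n) * (exp (2 * y) - 1))"
    using assms by (intro mgf_lpp_rect) auto
  also have "sqrt (p * n * n) = n * sqrt p" by (simp add: real_sqrt_mult)
  finally show ?thesis .
qed

lemma upper_tail_triangle:
  fixes p \<epsilon> :: real
  assumes "0 < p" "p \<le> 1" "0 < \<epsilon>"
  shows "measure_pmf.prob (coins (upper_triangle n) (\<lambda>_. p))
      {c. real (lpp c (upper_triangle n)) \<ge> (1 + \<epsilon>) * 2 * (n * sqrt p)}
    \<le> exp (- (1 / 4) * (\<epsilon>\<^sup>2 / (1 + \<epsilon>)) * (n * sqrt p))"
proof -
  define N where "N = n * sqrt p"
  have N: "0 \<le> N" using assms by (simp add: N_def)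
  \<comment> \<open>This tilt is at most 1 and at most \<open>\<epsilon> / 2\<close>, so the
    quadratic bound on \<open>exp\<close> leaves the exponent \<open>- x * \<epsilon> / 2\<close>
    per unit of \<open>N\<close>, for small and large \<epsilon> alike; the denominator
    \<open>1 + \<epsilon>\<close> of the final rate comes from here.\<close>
  define x where "x = \<epsilon> / (2 * (1 + \<epsilon>))"
  have x: "0 < x" "x \<le> 1" using assms by (auto simp: x_def field_simps)
  let ?X = "\<lambda>c. real (lpp c (upper_triangle n))" and ?M = "coins (upper_triangle n) (\<lambda>_. p)"
  have "measure_pmf.prob ?M {c. ?X c \<ge> (1 + \<epsilon>) * 2 * N} \<le>
      measure_pmf.expectation ?M (\<lambda>c. exp (- x * ((1 + \<epsilon>) * N)) * exp (x / 2 * ?X c))"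
  proof (intro prob_le_expectation_pmf finite_set_coins finite_triangle)
    fix c assume "c \<in> {c. ?X c \<ge> (1 + \<epsilon>) * 2 * N}"
    hence "x / 2 * ((1 + \<epsilon>) * 2 * N) \<le> x / 2 * ?X c" using x by (intro mult_left_mono) auto
    moreover have "x / 2 * ((1 + \<epsilon>) * 2 * N) = x * ((1 + \<epsilon>) * N)" by (simp add: algebra_simps)
    ultimately show "1 \<le> exp (- x * ((1 + \<epsilon>) * N)) * exp (x / 2 * ?X c)"
      unfolding exp_add[symmetric] one_le_exp_iff by linarith
  qed simp
  also have "\<dots> = exp (- x * ((1 + \<epsilon>) * N)) * measure_pmf.expectation ?M (\<lambda>c. exp (x / 2 * ?X c))"
    by simp
  also have "\<dots> \<le> exp (- x * ((1 + \<epsilon>) * N)) * exp (N * (exp (2 * (x / 2)) - 1))"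
    using mgf_triangle[of p "x / 2" n] assms x by (intro mult_left_mono) (auto simp: N_def)
  also have "\<dots> = exp (N * (exp x - 1 - x * (1 + \<epsilon>)))"
    unfolding exp_add[symmetric] by (simp add: algebra_simps)
  also have "\<dots> \<le> exp (- (1 / 4) * (\<epsilon>\<^sup>2 / (1 + \<epsilon>)) * N)"
  proof -
    have "exp x - 1 - x * (1 + \<epsilon>) \<le> x * (x - \<epsilon>)"
      using exp_le_quadratic[of x] x by (simp add: algebra_simps power2_eq_square)
    also have "\<dots> \<le> x * (- \<epsilon> / 2)"
    proof (rule mult_left_mono)
      have "x \<le> \<epsilon> / 2" unfolding x_def using assms by (intro divide_left_mono) auto
      thus "x - \<epsilon> \<le> - \<epsilon> / 2" by simp
    qed (use x in simp)
    also have "\<dots> = - (1 / 4) * (\<epsilon>\<^sup>2 / (1 + \<epsilon>))"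
      using assms by (simp add: x_def field_simps power2_eq_square)
    finally have "N * (exp x - 1 - x * (1 + \<epsilon>)) \<le> N * (- (1 / 4) * (\<epsilon>\<^sup>2 / (1 + \<epsilon>)))"
      using N by (rule mult_left_mono)
    thus ?thesis by (simp only: exp_le_cancel_iff mult.commute)
  qed
  finally show ?thesis unfolding N_def .
qed

text \<open>Jensen's inequality for \<open>exp\<close>, in the form of its tangent at the mean,
  turns the moment bound into a bound on the mean without integrating the tail.\<close>

lemma expectation_triangle_le:
  fixes p \<epsilon> :: real
  assumes "0 < p" "p \<le> 1" "0 < \<epsilon>"
  shows "measure_pmf.expectation (coins (upper_triangle n) (\<lambda>_. p)) (\<lambda>c. real (lpp c (upper_triangle n)))
    \<le> (1 + \<epsilon>) * 2 * (n * sqrt p)"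
proof -
  define N where "N = n * sqrt p"
  have N: "0 \<le> N" using assms by (simp add: N_def)
  define y where "y = min \<epsilon> 1 / 2"
  have y: "0 < y" "2 * y \<le> 1" "2 * y \<le> \<epsilon>" using assms by (auto simp: y_def)
  let ?X = "\<lambda>c. real (lpp c (upper_triangle n))"
  let ?E = "measure_pmf.expectation (coins (upper_triangle n) (\<lambda>_. p))"
  define \<mu> where "\<mu> = ?E ?X"
  have "exp (y * \<mu>) = ?E (\<lambda>c. exp (y * \<mu>) * (1 + y * (?X c - \<mu>)))"
    by (simp add: \<mu>_def)
  also have "\<dots> \<le> ?E (\<lambda>c. exp (y * ?X c))"
  proof (intro integral_mono integrable_coins finite_triangle)
    fix c
    have "exp (y * \<mu>) * (1 + y * (?X c - \<mu>)) \<le> exp (y * \<mu>) * exp (y * (?X c - \<mu>))"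
      by (intro mult_left_mono exp_ge_add_one_self) auto
    also have "\<dots> = exp (y * ?X c)" unfolding exp_add[symmetric] by (simp add: algebra_simps)
    finally show "exp (y * \<mu>) * (1 + y * (?X c - \<mu>)) \<le> exp (y * ?X c)" .
  qed
  also have "\<dots> \<le> exp (N * (exp (2 * y) - 1))"
    unfolding N_def using assms y by (intro mgf_triangle) auto
  finally have "y * \<mu> \<le> N * (exp (2 * y) - 1)" by simp
  also have "\<dots> \<le> N * (2 * y + (2 * y)\<^sup>2)"
    using exp_le_quadratic[of "2 * y"] y N by (intro mult_left_mono) auto
  also have "\<dots> = y * (2 * N * (1 + 2 * y))" by (simp add: algebra_simps power2_eq_square)
  finally have "\<mu> \<le> 2 * N * (1 + 2 * y)" using y(1) by (simp only: mult_le_cancel_left_pos)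
  also have "\<dots> \<le> 2 * N * (1 + \<epsilon>)" using y N by (intro mult_left_mono) auto
  finally show ?thesis by (simp add: \<mu>_def N_def mult_ac)
qed

lemma expectation_ge_of_lower_tail:
  fixes X :: "'a \<Rightarrow> real"
  assumes "finite (set_pmf M)" "\<And>x. 0 \<le> X x" "0 \<le> t" "measure_pmf.prob M {x. X x \<le> t} \<le> \<delta>"
  shows "t * (1 - \<delta>) \<le> measure_pmf.expectation M X"
proof -
  have int: "integrable (measure_pmf M) g" for g :: "'a \<Rightarrow> real"
    by (intro integrable_measure_pmf_finite assms(1))
  have "t * (1 - \<delta>) \<le> t * (1 - measure_pmf.prob M {x. X x \<le> t})"
    using assms by (intro mult_left_mono) auto
  also have "\<dots> = measure_pmf.expectation M (\<lambda>x. t * (1 - indicator {x. X x \<le> t} x))"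
    using int by (simp add: measure_pmf.prob_space)
  also have "\<dots> \<le> measure_pmf.expectation M X"
    by (intro integral_mono int) (use assms in \<open>auto simp: indicator_def\<close>)
  finally show ?thesis .
qed

theorem theorem10:
  "\<exists>C>0. \<forall>\<epsilon>::real. \<epsilon> > 0 \<longrightarrow>
     (\<exists>(p0::real) (A::real). 0 < p0 \<and> p0 \<le> 1 \<and>
       (\<forall>(p::real) (n::nat). 0 < p \<and> p \<le> p0 \<and> n > 0 \<and> real n \<ge> A / sqrt p \<longrightarrow>
          ((1 - \<epsilon>) * 2 * real n * sqrt p
             \<le> measure_pmf.expectation (sym_bigraph_pmf n p) (\<lambda>G. real (L G)) \<and>
           measure_pmf.expectation (sym_bigraph_pmf n p) (\<lambda>G. real (L G))
             \<le> (1 + \<epsilon>) * 2 * real n * sqrt p) \<and>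
          (\<forall>m. is_median (sym_bigraph_pmf n p) (\<lambda>G. real (L G)) m \<longrightarrow>
             m \<in> {(1 - \<epsilon>) * 2 * real n * sqrt p .. (1 + \<epsilon>) * 2 * real n * sqrt p}) \<and>
          (measure_pmf.prob (sym_bigraph_pmf n p)
               {G. real (L G) \<le> (1 - \<epsilon>) * 2 * real n * sqrt p}
             \<le> exp (- C * \<epsilon>\<^sup>2 * real n * sqrt p) \<and>
           measure_pmf.prob (sym_bigraph_pmf n p)
               {G. real (L G) \<ge> (1 + \<epsilon>) * 2 * real n * sqrt p}
             \<le> exp (- C * (\<epsilon>\<^sup>2 / (1 + \<epsilon>)) * real n * sqrt p))))"
proof (rule exI[of _ "1/4"], intro conjI allI impI)
  fix \<epsilon> :: real assume \<epsilon>: "0 < \<epsilon>"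
  \<comment> \<open>Half of \<epsilon>, because the mean pays twice, for the level and for the
    failure probability, and \<open>(1 - e)^2 \<ge> 1 - \<epsilon>\<close>. The cap covers large
    \<epsilon>, as the block argument requires \<open>e \<le> 1\<close>.\<close>
  define e where "e = min \<epsilon> 1 / 2"
  have e: "0 < e" "e \<le> 1 / 2" "2 * e \<le> \<epsilon>" using \<epsilon> by (auto simp: e_def)
  \<comment> \<open>The value 1/4 is the constant of the upper tail; the free choice of the rate
    lets the lower tail match it for every \<epsilon>. The summand 1 bounds the lower tail by
    \<open>exp (- N)\<close>, which serves mean and median.\<close>
  define D where "D = 1 + \<epsilon>\<^sup>2 / 4"
  have D: "1 \<le> D" "\<epsilon>\<^sup>2 / 4 \<le> D" by (auto simp: D_def)
  have "e \<le> 1" "0 < D" using e D by auto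
  then obtain A0 p0 where A0: "0 < p0" "p0 \<le> 1" and low:
    "\<And>(p::real) (n::nat). \<lbrakk>0 < p; p \<le> p0; A0 \<le> n * sqrt p\<rbrakk> \<Longrightarrow>
       measure_pmf.prob (coins (upper_triangle n) (\<lambda>_. p))
         {c. real (lpp c (upper_triangle n)) \<le> (1 - e) * 2 * (n * sqrt p)} \<le> exp (- D * (n * sqrt p))"
    using lower_tail_triangle[of e D] e(1) by metis
  \<comment> \<open>In this order, the bounds serve the block estimate, a lower-tail probability
    below 1/2 for the median, one of at most \<open>e\<close> for the mean, and an upper-tail
    exponent of at least 2 for the median.\<close>
  define A where "A = Max {A0, 2, ln (1 / e), 8 * (1 + \<epsilon>) / \<epsilon>\<^sup>2}"
  have A: "A0 \<le> A" "2 \<le> A" "ln (1 / e) \<le> A" "8 * (1 + \<epsilon>) / \<epsilon>\<^sup>2 \<le> A"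
    unfolding A_def by (intro Max_ge; simp)+
  have exp2: "exp (- x) < 1 / 2" if "2 \<le> x" for x :: real
  proof -
    have "2 < exp x" using exp_ge_add_one_self[of x] that by linarith
    thus ?thesis by (simp add: exp_minus field_simps)
  qed
  show "\<exists>(p0::real) (A::real). 0 < p0 \<and> p0 \<le> 1 \<and>
       (\<forall>(p::real) (n::nat). 0 < p \<and> p \<le> p0 \<and> n > 0 \<and> real n \<ge> A / sqrt p \<longrightarrow>
          ((1 - \<epsilon>) * 2 * real n * sqrt p
             \<le> measure_pmf.expectation (sym_bigraph_pmf n p) (\<lambda>G. real (L G)) \<and>
           measure_pmf.expectation (sym_bigraph_pmf n p) (\<lambda>G. real (L G))
             \<le> (1 + \<epsilon>) * 2 * real n * sqrt p) \<and>
          (\<forall>m. is_median (sym_bigraph_pmf n p) (\<lambda>G. real (L G)) m \<longrightarrow>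
             m \<in> {(1 - \<epsilon>) * 2 * real n * sqrt p .. (1 + \<epsilon>) * 2 * real n * sqrt p}) \<and>
          (measure_pmf.prob (sym_bigraph_pmf n p)
               {G. real (L G) \<le> (1 - \<epsilon>) * 2 * real n * sqrt p}
             \<le> exp (- (1 / 4) * \<epsilon>\<^sup>2 * real n * sqrt p) \<and>
           measure_pmf.prob (sym_bigraph_pmf n p)
               {G. real (L G) \<ge> (1 + \<epsilon>) * 2 * real n * sqrt p}
             \<le> exp (- (1 / 4) * (\<epsilon>\<^sup>2 / (1 + \<epsilon>)) * real n * sqrt p)))"
  proof (rule exI[of _ p0], rule exI[of _ A], intro conjI[OF A0(1)] conjI[OF A0(2)] allI impI, elim conjE)
    fix p :: real and n :: nat
    assume p: "0 < p" "p \<le> p0" and n: "0 < n" "A / sqrt p \<le> real n"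
    have p1: "p \<le> 1" using p A0 by simp
    define N where "N = n * sqrt p"
    have N: "A \<le> N" using n p by (simp add: N_def divide_le_eq)
    have N2: "2 \<le> N" using N A by simp
    let ?M = "coins (upper_triangle n) (\<lambda>_. p)" and ?X = "\<lambda>c. real (lpp c (upper_triangle n))"
    have lo: "measure_pmf.prob ?M {c. ?X c \<le> (1 - e) * 2 * N} \<le> exp (- D * N)"
      using low[of p n] p N A by (simp add: N_def)
    have DN: "N \<le> D * N" "\<epsilon>\<^sup>2 / 4 * N \<le> D * N"
      using D N2 mult_right_mono[of 1 D N] by (auto intro: mult_right_mono)
    have lowset: "measure_pmf.prob ?M {c. ?X c \<le> u} \<le> exp (- D * N)" if "u \<le> (1 - \<epsilon>) * 2 * N" for u
    proof -
      have "(1 - \<epsilon>) * (2 * N) \<le> (1 - e) * (2 * N)" using e N2 by (intro mult_right_mono) auto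
      hence "u \<le> (1 - e) * 2 * N" using that unfolding mult.assoc by linarith
      hence "measure_pmf.prob ?M {c. ?X c \<le> u} \<le> measure_pmf.prob ?M {c. ?X c \<le> (1 - e) * 2 * N}"
        by (intro measure_pmf.finite_measure_mono) auto
      with lo show ?thesis by linarith
    qed
    have up: "measure_pmf.prob ?M {c. ?X c \<ge> (1 + \<epsilon>) * 2 * N}
        \<le> exp (- (1 / 4) * (\<epsilon>\<^sup>2 / (1 + \<epsilon>)) * N)"
      unfolding N_def by (rule upper_tail_triangle[OF p(1) p1 \<epsilon>])
    have lowE: "(1 - \<epsilon>) * 2 * N \<le> measure_pmf.expectation ?M ?X"
    proof -
      have "exp (- D * N) \<le> exp (- ln (1 / e))" using DN(1) N A(3) by simp
      also have "\<dots> = e" using e(1) by (simp add: ln_div)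
      finally have "measure_pmf.prob ?M {c. ?X c \<le> (1 - e) * 2 * N} \<le> e" using lo by linarith
      hence "(1 - e) * 2 * N * (1 - e) \<le> measure_pmf.expectation ?M ?X"
        using e N2 by (intro expectation_ge_of_lower_tail finite_set_coins) auto
      moreover have "(1 - \<epsilon>) * (2 * N) \<le> ((1 - e) * (1 - e)) * (2 * N)"
      proof (rule mult_right_mono)
        have "1 - 2 * e \<le> (1 - e) * (1 - e)" by (simp add: algebra_simps)
        thus "1 - \<epsilon> \<le> (1 - e) * (1 - e)" using e(3) by linarith
      qed (use N2 in simp)
      ultimately show ?thesis by (simp add: mult_ac)
    qed
    have upE: "measure_pmf.expectation ?M ?X \<le> (1 + \<epsilon>) * 2 * N"
      unfolding N_def by (rule expectation_triangle_le[OF p(1) p1 \<epsilon>])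
    have assoc: "x * real n * sqrt p = x * N" for x by (simp add: N_def)
    have med: "m \<in> {(1 - \<epsilon>) * 2 * N .. (1 + \<epsilon>) * 2 * N}"
      if "is_median (sym_bigraph_pmf n p) (\<lambda>G. real (L G)) m" for m
    proof -
      have m: "1 / 2 \<le> measure_pmf.prob ?M {c. ?X c \<le> m}" "1 / 2 \<le> measure_pmf.prob ?M {c. ?X c \<ge> m}"
        using that prob_sym_bigraph[of n p "\<lambda>v. real v \<le> m"] prob_sym_bigraph[of n p "\<lambda>v. real v \<ge> m"]
        by (auto simp: is_median_def)
      have "\<not> m < (1 - \<epsilon>) * 2 * N"
      proof
        assume "m < (1 - \<epsilon>) * 2 * N"
        hence "measure_pmf.prob ?M {c. ?X c \<le> m} \<le> exp (- (D * N))" using lowset[of m] by simp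
        also have "\<dots> < 1 / 2" by (rule exp2) (use DN(1) N2 in linarith)
        finally show False using m by simp
      qed
      moreover have "\<not> m > (1 + \<epsilon>) * 2 * N"
      proof
        assume "m > (1 + \<epsilon>) * 2 * N"
        hence "measure_pmf.prob ?M {c. ?X c \<ge> m} \<le> measure_pmf.prob ?M {c. ?X c \<ge> (1 + \<epsilon>) * 2 * N}"
          by (intro measure_pmf.finite_measure_mono) auto
        also have "\<dots> \<le> exp (- (1 / 4 * (\<epsilon>\<^sup>2 / (1 + \<epsilon>)) * N))" using up by simp
        also have "\<dots> < 1 / 2"
        proof (rule exp2)
          have "8 * (1 + \<epsilon>) / \<epsilon>\<^sup>2 \<le> N" using A N by simp
          hence "1 / 4 * (\<epsilon>\<^sup>2 / (1 + \<epsilon>)) * (8 * (1 + \<epsilon>) / \<epsilon>\<^sup>2) \<le> 1 / 4 * (\<epsilon>\<^sup>2 / (1 + \<epsilon>)) * N"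
            using \<epsilon> by (intro mult_left_mono) auto
          moreover have "1 / 4 * (\<epsilon>\<^sup>2 / (1 + \<epsilon>)) * (8 * (1 + \<epsilon>) / \<epsilon>\<^sup>2) = 2"
            using \<epsilon> by (simp add: divide_eq_eq)
          ultimately show "2 \<le> 1 / 4 * (\<epsilon>\<^sup>2 / (1 + \<epsilon>)) * N" by simp
        qed
        finally show False using m by simp
      qed
      ultimately show ?thesis by simp
    qed
    have lt: "measure_pmf.prob ?M {c. ?X c \<le> (1 - \<epsilon>) * 2 * N} \<le> exp (- (1 / 4) * \<epsilon>\<^sup>2 * N)"
      using lowset[of "(1 - \<epsilon>) * 2 * N"] DN(2) by (auto elim: order.trans)
    note eqs = prob_sym_bigraph[of n p "\<lambda>v. real v \<le> (1 - \<epsilon>) * 2 * N"]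
      prob_sym_bigraph[of n p "\<lambda>v. real v \<ge> (1 + \<epsilon>) * 2 * N"]
      expectation_sym_bigraph[of n p real]
    show "((1 - \<epsilon>) * 2 * real n * sqrt p
             \<le> measure_pmf.expectation (sym_bigraph_pmf n p) (\<lambda>G. real (L G)) \<and>
           measure_pmf.expectation (sym_bigraph_pmf n p) (\<lambda>G. real (L G))
             \<le> (1 + \<epsilon>) * 2 * real n * sqrt p) \<and>
          (\<forall>m. is_median (sym_bigraph_pmf n p) (\<lambda>G. real (L G)) m \<longrightarrow>
             m \<in> {(1 - \<epsilon>) * 2 * real n * sqrt p .. (1 + \<epsilon>) * 2 * real n * sqrt p}) \<and>
          (measure_pmf.prob (sym_bigraph_pmf n p)
               {G. real (L G) \<le> (1 - \<epsilon>) * 2 * real n * sqrt p}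
             \<le> exp (- (1 / 4) * \<epsilon>\<^sup>2 * real n * sqrt p) \<and>
           measure_pmf.prob (sym_bigraph_pmf n p)
               {G. real (L G) \<ge> (1 + \<epsilon>) * 2 * real n * sqrt p}
             \<le> exp (- (1 / 4) * (\<epsilon>\<^sup>2 / (1 + \<epsilon>)) * real n * sqrt p))"
      unfolding assoc eqs using lowE upE med lt up by blast
  qed
qed simp

end
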